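(* Let $(J,W)$ be a pure graphon. Then its automorphism group ${\rm Aut}(J,W)$, equipped with the metric $d(\sigma,\tau)=\sup_{x\in\overline{J}}\overline{r}_W(x^\sigma,x^\tau)$, is compact.
   Context: A graphon is a pair $(J,W)$ where $J$ is a standard probability space with probability measure $\pi$ and $W:J\times J\to[0,1]$ is a symmetric measurable function; it is assumed that every section $W(x,\cdot)$ is measurable. The neighborhood distance is $r_W(x,y)=\int_J|W(x,z)-W(y,z)|\,d\pi(z)$. The graphon is pure if $r_W$ is a metric on $J$, the metric space $(J,r_W)$ is complete, and $\pi$ has full support (every nonempty $r_W$-open set has positive measure). The 2-neighborhood distance is $\overline{r}_W(x,y)=\int_J\bigl|\int_J (W(x,u)-W(y,u))W(u,z)\,d\pi(u)\bigr|\,d\pi(z)$; for a pure graphon it is a metric on $J$. $(\overline{J},\overline{r}_W)$ denotes the completion of $(J,\overline{r}_W)$ (it is a compact metric space); $\pi$ is extended to $\overline{J}$ by giving the new points measure $0$, and $W$ is extended to a graphon $\overline{W}$ on $\overline{J}$ (for $x\in\overline J$, $\overline W(x,\cdot)$ is the weak limit of $W(x_n,\cdot)$ for $x_n\in J$, $x_n\to x$ in $\overline r_W$). An automorphism of a pure graphon $(J,W)$ is a measure preserving bijection $\sigma:J\to J$ such that for every $x\in J$, $W(x^\sigma,y^\sigma)=W(x,y)$ for almost all $y\in J$. Every automorphism preserves $\overline{r}_W$ and hence extends to an isometry of $(\overline{J},\overline{r}_W)$; the metric $d$ above is computed with these extensions. *)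

theory Defs
  imports "HOL-Probability.Probability" "HOL-Algebra.Bij"
begin

section \<open>Standard probability spaces\<close>

text \<open>Isomorphism mod 0: a measurable bijection with measurable inverse, transporting one
  measure to the other, defined after removing a null set on either side.\<close>

definition isomorphic_mod_0 :: "'a measure \<Rightarrow> 'b measure \<Rightarrow> bool" where
  "isomorphic_mod_0 M N \<longleftrightarrow>
     (\<exists>A\<in>null_sets M. \<exists>B\<in>null_sets N. \<exists>f.
        let M' = restrict_space M (space M - A); N' = restrict_space N (space N - B)
        in bij_betw f (space M') (space N') \<and>
           f \<in> measurable M' N' \<and>
           inv_into (space M') f \<in> measurable N' M' \<and>
           distr M' N' f = N')"

text \<open>Lebesgue--Rokhlin spaces: complete probability spaces that are isomorphic mod 0 to the
  completion of a Borel probability measure on a Polish space. Since every Polish space is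
  Borel isomorphic to a Borel subset of the line, it is enough to allow the line.\<close>

definition standard_prob_space :: "'a measure \<Rightarrow> bool" where
  "standard_prob_space M \<longleftrightarrow>
     prob_space M \<and>
     (\<forall>B\<in>null_sets M. \<forall>A\<subseteq>B. A \<in> sets M) \<and>
     (\<exists>N::real measure. prob_space N \<and> sets N = sets borel \<and> isomorphic_mod_0 M (completion N))"

section \<open>Graphons\<close>

text \<open>A pair \<open>(J, W)\<close> is given by a measure space \<open>M\<close> with underlying set \<open>J = space M\<close> and by
  \<open>W\<close>, whose values off \<open>J \<times> J\<close> are irrelevant. As usual on complete spaces, measurability on
  \<open>J \<times> J\<close> refers to the completed product; it does not imply measurability of every section.\<close>

definition graphon :: "'a measure \<Rightarrow> ('a \<Rightarrow> 'a \<Rightarrow> real) \<Rightarrow> bool" where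
  "graphon M W \<longleftrightarrow>
     standard_prob_space M \<and>
     (\<lambda>(x, y). W x y) \<in> borel_measurable (completion (M \<Otimes>\<^sub>M M)) \<and>
     (\<forall>x\<in>space M. W x \<in> borel_measurable M) \<and>
     (\<forall>x\<in>space M. \<forall>y\<in>space M. W x y = W y x) \<and>
     (\<forall>x\<in>space M. \<forall>y\<in>space M. 0 \<le> W x y \<and> W x y \<le> 1)"

definition nbhd_dist :: "'a measure \<Rightarrow> ('a \<Rightarrow> 'a \<Rightarrow> real) \<Rightarrow> 'a \<Rightarrow> 'a \<Rightarrow> real" where
  "nbhd_dist M W x y = (\<integral>z. \<bar>W x z - W y z\<bar> \<partial>M)"

definition nbhd2_dist :: "'a measure \<Rightarrow> ('a \<Rightarrow> 'a \<Rightarrow> real) \<Rightarrow> 'a \<Rightarrow> 'a \<Rightarrow> real" where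
  "nbhd2_dist M W x y = (\<integral>z. \<bar>\<integral>u. (W x u - W y u) * W u z \<partial>M\<bar> \<partial>M)"

definition pure_graphon :: "'a measure \<Rightarrow> ('a \<Rightarrow> 'a \<Rightarrow> real) \<Rightarrow> bool" where
  "pure_graphon M W \<longleftrightarrow>
     graphon M W \<and>
     Metric_space (space M) (nbhd_dist M W) \<and>
     Metric_space.mcomplete (space M) (nbhd_dist M W) \<and>
     (\<forall>U. openin (Metric_space.mtopology (space M) (nbhd_dist M W)) U \<and> U \<noteq> {}
        \<longrightarrow> emeasure M U > 0)"

section \<open>Completion of a metric space\<close>

text \<open>The points of the completion of \<open>(S, d)\<close> are the classes of Cauchy sequences in \<open>S\<close>
  modulo sequences at distance tending to \<open>0\<close>; a point of \<open>S\<close> is identified with the class of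
  its constant sequence.\<close>

definition cauchy_equiv :: "'a set \<Rightarrow> ('a \<Rightarrow> 'a \<Rightarrow> real) \<Rightarrow> ((nat \<Rightarrow> 'a) \<times> (nat \<Rightarrow> 'a)) set" where
  "cauchy_equiv S d =
     {(s, t). Metric_space.MCauchy S d s \<and> Metric_space.MCauchy S d t \<and>
              (\<lambda>n. d (s n) (t n)) \<longlonglongrightarrow> 0}"

definition completion_points :: "'a set \<Rightarrow> ('a \<Rightarrow> 'a \<Rightarrow> real) \<Rightarrow> (nat \<Rightarrow> 'a) set set" where
  "completion_points S d = {s. Metric_space.MCauchy S d s} // cauchy_equiv S d"

definition completion_dist ::
  "('a \<Rightarrow> 'a \<Rightarrow> real) \<Rightarrow> (nat \<Rightarrow> 'a) set \<Rightarrow> (nat \<Rightarrow> 'a) set \<Rightarrow> real" where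
  "completion_dist d X Y = (THE r. \<forall>s\<in>X. \<forall>t\<in>Y. (\<lambda>n. d (s n) (t n)) \<longlonglongrightarrow> r)"

text \<open>The extension of an isometry \<open>\<sigma>\<close> of \<open>(S, d)\<close> maps the class of \<open>s\<close> to the class of
  \<open>\<sigma> \<circ> s\<close>.\<close>

definition completion_map ::
  "'a set \<Rightarrow> ('a \<Rightarrow> 'a \<Rightarrow> real) \<Rightarrow> ('a \<Rightarrow> 'a) \<Rightarrow> (nat \<Rightarrow> 'a) set \<Rightarrow> (nat \<Rightarrow> 'a) set" where
  "completion_map S d \<sigma> X = cauchy_equiv S d `` ((\<lambda>s. \<sigma> \<circ> s) ` X)"

section \<open>The automorphism group\<close>

text \<open>Membership in \<^term>\<open>Bij J\<close> means being a bijection of \<open>J\<close> onto itself, extended by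
  \<open>undefined\<close> off \<open>J\<close>.\<close>

definition graphon_auto :: "'a measure \<Rightarrow> ('a \<Rightarrow> 'a \<Rightarrow> real) \<Rightarrow> ('a \<Rightarrow> 'a) set" where
  "graphon_auto M W =
     {\<sigma> \<in> Bij (space M).
        \<sigma> \<in> measurable M M \<and> distr M M \<sigma> = M \<and>
        (\<forall>x\<in>space M. AE y in M. W (\<sigma> x) (\<sigma> y) = W x y)}"

definition graphon_Aut :: "'a measure \<Rightarrow> ('a \<Rightarrow> 'a \<Rightarrow> real) \<Rightarrow> ('a \<Rightarrow> 'a) monoid" where
  "graphon_Aut M W = BijGroup (space M) \<lparr>carrier := graphon_auto M W\<rparr>"

text \<open>The value \<open>0\<close> off the group is needed because \<^const>\<open>Metric_space\<close> asks for symmetry and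
  nonnegativity on the whole type.\<close>

definition aut_dist ::
  "'a measure \<Rightarrow> ('a \<Rightarrow> 'a \<Rightarrow> real) \<Rightarrow> ('a \<Rightarrow> 'a) \<Rightarrow> ('a \<Rightarrow> 'a) \<Rightarrow> real" where
  "aut_dist M W \<sigma> \<tau> =
     (let J = space M; r = nbhd2_dist M W in
      if \<sigma> \<in> graphon_auto M W \<and> \<tau> \<in> graphon_auto M W
      then (SUP X\<in>completion_points J r.
              completion_dist r (completion_map J r \<sigma> X) (completion_map J r \<tau> X))
      else 0)"

end

theory Submission
  imports Defs
begin

text \<open>Write \<open>r\<close> and \<open>r2\<close> for the two neighborhood distances and \<open>k x y = \<integral>u. W x u * W y u\<close>. Then
  \<open>r2 x y = \<integral>z. \<bar>k x z - k y z\<bar>\<close>, \<open>k\<close> is 1-Lipschitz for \<open>r\<close>, and automorphisms preserve \<open>r\<close>, \<open>k\<close> and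
  \<open>r2\<close>. Finitely many \<open>r\<close>-balls cover \<open>J\<close> up to small measure, so \<open>r2\<close> is totally bounded, and hence so is
  the group under the uniform distance. For completeness, full support makes \<open>r2\<close>-closeness
  of \<open>\<tau> x\<close> and \<open>x\<close> force \<open>k (\<tau> x) x\<close> to be close to \<open>k x x = k (\<tau> x) (\<tau> x)\<close>, that is, \<open>\<tau> x\<close> and \<open>x\<close>
  to be \<open>r\<close>-close. A Cauchy sequence of automorphisms and the sequence of its inverses therefore
  converge pointwise in the complete metric \<open>r\<close>, to mutually inverse isometries. Fatou's lemma on open
  sets shows that the limit preserves \<open>\<pi>\<close> and \<open>W\<close>; passing from open sets to all of \<open>sets M\<close> uses that \<open>M\<close>
  is standard, so that the Borel sets of the separable metric \<open>r\<close> generate it modulo null sets.\<close>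

section \<open>Standard probability spaces\<close>

text \<open>An isomorphism mod 0 lives only off null sets \<open>A\<close> and \<open>B\<close>.
  Extending it by \<open>0\<close> and its inverse by \<open>x0\<close> gives total maps with
  \<open>\<psi> (f x) = x\<close> almost everywhere. Of measure preservation only the pullback of
  null sets is kept, which suffices to carry almost everywhere statements from \<open>N\<close> to
  \<open>M\<close>.\<close>

lemma standard_prob_space_coordinate:
  assumes "standard_prob_space M"
  obtains N :: "real measure" and f \<psi> where
    "sets N = sets borel"
    "f \<in> borel_measurable M" "\<And>E. E \<in> null_sets N \<Longrightarrow> f -` E \<inter> space M \<in> null_sets M"
    "\<psi> \<in> measurable (completion N) M" "AE x in M. \<psi> (f x) = x"
proof -
  from assms interpret prob_space M by (simp add: standard_prob_space_def)
  from assms obtain N :: "real measure" where N: "sets N = sets borel" "isomorphic_mod_0 M (completion N)"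
    by (auto simp: standard_prob_space_def)
  obtain x0 where x0: "x0 \<in> space M" using not_empty by auto
  have spN: "space N = UNIV" using sets_eq_imp_space_eq[OF N(1)] by simp
  obtain A B f0 where A: "A \<in> null_sets M" and B: "B \<in> null_sets (completion N)"
    and bij: "bij_betw f0 (space M - A) (- B)"
    and f0: "f0 \<in> measurable (restrict_space M (space M - A)) (restrict_space (completion N) (- B))"
    and inv: "inv_into (space M - A) f0 \<in> measurable (restrict_space (completion N) (- B)) (restrict_space M (space M - A))"
    and distr: "distr (restrict_space M (space M - A)) (restrict_space (completion N) (- B)) f0
                  = restrict_space (completion N) (- B)"
    using N(2) unfolding isomorphic_mod_0_def Let_def
    by (auto simp: space_restrict_space spN Compl_eq_Diff_UNIV Int_absorb2[OF Diff_subset])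
  have A': "space M - A \<in> sets M" "A \<in> sets M" using A by auto
  have B': "- B \<in> sets (completion N)" "B \<in> sets (completion N)"
    using B sets.compl_sets[of B "completion N"] by (auto simp: spN Compl_eq_Diff_UNIV)
  define f where "f = (\<lambda>x. if x \<in> space M - A then f0 x else 0)"
  define \<psi> where "\<psi> = (\<lambda>s. if s \<in> - B then inv_into (space M - A) f0 s else x0)"
  have f0': "f0 \<in> measurable (restrict_space M (space M - A)) (completion N)"
    using f0 by (simp add: measurable_restrict_space2_iff)
  have fc: "f \<in> measurable M (completion N)"
    unfolding f_def using f0' A' by (subst measurable_restrict_space_iff[symmetric]) (auto simp: spN)
  have "f \<in> borel_measurable M"
    by (rule measurableI) (auto intro!: measurable_sets[OF fc] sets_completionI_sets simp: N(1))
  moreover have "f -` E \<inter> space M \<in> null_sets M" if E: "E \<in> null_sets N" for E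
  proof -
    have Ec: "E \<in> sets (completion N)" by (rule sets_completionI_sets[OF null_setsD2[OF E]])
    have EB: "E \<inter> - B \<in> null_sets (completion N)"
      by (rule null_sets_completion_subset[OF _ null_sets_completionI[OF E]]) auto
    then have EB': "E \<inter> - B \<in> sets (restrict_space (completion N) (- B))"
      by (auto simp: sets_restrict_space image_iff intro!: bexI[of _ E] Ec)
    have "emeasure (restrict_space (completion N) (- B)) (E \<inter> - B) = emeasure (completion N) (E \<inter> - B)"
      by (rule emeasure_restrict_space) (use B' in \<open>simp_all add: spN\<close>)
    also have "\<dots> = 0" by (rule null_setsD1[OF EB])
    finally have "emeasure (distr (restrict_space M (space M - A)) (restrict_space (completion N) (- B)) f0)
        (E \<inter> - B) = 0"
      by (simp only: distr)
    then have "emeasure (restrict_space M (space M - A)) (f0 -` (E \<inter> - B) \<inter> (space M - A)) = 0"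
      by (subst (asm) emeasure_distr[OF f0 EB']) (simp add: space_restrict_space Int_absorb2[OF Diff_subset])
    moreover have eq: "f0 -` (E \<inter> - B) \<inter> (space M - A) = f -` E \<inter> (space M - A)"
      using bij by (auto simp: f_def bij_betw_def)
    ultimately have 0: "emeasure M (f -` E \<inter> (space M - A)) = 0"
      using A' by (subst (asm) emeasure_restrict_space) auto
    have m: "f -` E \<inter> space M \<in> sets M" using measurable_sets[OF fc Ec] .
    \<comment> \<open>Points of \<open>A\<close> take the default value \<open>0\<close>, which may
      lie in \<open>E\<close>; they enlarge the preimage by at most the null set
      \<open>A\<close>.\<close>
    have "f -` E \<inter> space M \<subseteq> (f -` E \<inter> (space M - A)) \<union> A" by auto
    moreover have "(f -` E \<inter> (space M - A)) \<in> null_sets M"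
    proof -
      have "f -` E \<inter> (space M - A) = (f -` E \<inter> space M) - A" by auto
      then show ?thesis using 0 m A' by (auto simp: null_sets_def)
    qed
    ultimately show ?thesis using m A null_sets_subset[of "(f -` E \<inter> (space M - A)) \<union> A" M] by auto
  qed
  moreover have "\<psi> \<in> measurable (completion N) M"
    unfolding \<psi>_def using inv B' x0
    by (subst measurable_restrict_space_iff[symmetric]) (auto simp: spN measurable_restrict_space2_iff)
  moreover have "AE x in M. \<psi> (f x) = x"
    using AE_not_in[OF A] AE_space
  proof eventually_elim
    case (elim x)
    then have "f0 x \<in> - B" using bij by (auto simp: bij_betw_def)
    with elim bij show ?case by (auto simp: \<psi>_def f_def bij_betw_def)
  qed
  ultimately show thesis using that N(1) by blast
qed

text \<open>The image of an \<open>M\<close>-measurable set under \<open>h\<close> need not be Borel. Instead the graph of \<open>h\<close>, read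
  in the real coordinate of \<open>M\<close>, is Borel up to a null set; compact subsets of the graph have compact
  projections to the second factor.\<close>

lemma inj_measurable_generates_mod_null:
  fixes h :: "'a \<Rightarrow> nat \<Rightarrow> real"
  assumes std: "standard_prob_space M" and h: "h \<in> borel_measurable M" "inj_on h (space M)"
    and A: "A \<in> sets M"
  obtains T where "T \<in> sets borel" "h -` T \<inter> space M \<subseteq> A" "A - h -` T \<in> null_sets M"
proof -
  from std interpret prob_space M by (simp add: standard_prob_space_def)
  obtain N :: "real measure" and f \<psi> where N: "sets N = sets borel"
    and f: "f \<in> borel_measurable M" "\<And>E. E \<in> null_sets N \<Longrightarrow> f -` E \<inter> space M \<in> null_sets M"
    and \<psi>: "\<psi> \<in> measurable (completion N) M" "AE x in M. \<psi> (f x) = x"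
    by (rule standard_prob_space_coordinate[OF std]) (rule that)
  have spN: "space N = UNIV" using sets_eq_imp_space_eq[OF N] by simp
  have h\<psi>: "(\<lambda>s. h (\<psi> s) n) \<in> borel_measurable (completion N)" for n
    using measurable_compose[OF \<psi>(1) h(1)] by (rule measurable_product_then_coordinatewise)
  \<comment> \<open>The coordinates of \<open>h (\<psi> s)\<close> are measurable only for the
    completion of \<open>N\<close>. Each is replaced by a Borel function equal to it almost
    everywhere; as there are countably many, a single null set \<open>N1\<close> collects all
    exceptions.\<close>
  have "\<exists>g\<in>borel_measurable N. AE s in N. h (\<psi> s) n = g s" for n
    by (rule completion_ex_borel_measurable_real[OF h\<psi>])
  then obtain g where g: "\<And>n. g n \<in> borel_measurable N" "\<And>n. AE s in N. h (\<psi> s) n = g n s"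
    by metis
  define G where "G = (\<lambda>s n. g n s)"
  have "G \<in> borel_measurable N"
    unfolding G_def by (rule measurable_coordinatewise_then_product) (use g in auto)
  then have G: "G \<in> borel_measurable borel" using N measurable_cong_sets by blast
  have "AE s in N. \<forall>n. h (\<psi> s) n = g n s" using g(2) by (simp add: AE_all_countable)
  then have "AE s in N. h (\<psi> s) = G s" by eventually_elim (auto simp: G_def)
  then obtain N1 where N1: "N1 \<in> null_sets N" "\<And>s. s \<notin> N1 \<Longrightarrow> h (\<psi> s) = G s"
    by (auto simp: eventually_ae_filter spN)
  have S: "\<psi> -` A \<in> sets (completion N)" using measurable_sets[OF \<psi>(1) A] by (simp add: spN)
  obtain S1 N2 N3 where S1: "\<psi> -` A = S1 \<union> N2" "N2 \<subseteq> N3" "N3 \<in> null_sets N" "S1 \<in> sets N"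
    using sets_completionE[OF S] .
  \<comment> \<open>\<open>S'\<close> is a Borel part of the preimage of \<open>A\<close> under
    \<open>\<psi>\<close> on which \<open>G\<close> agrees with \<open>h (\<psi> s)\<close> exactly;
    only a null set is lost.\<close>
  define S' where "S' = S1 - N1"
  have S': "S' \<in> sets borel" using S1 N1 N unfolding S'_def by auto
  have S'_A: "\<psi> s \<in> A" "h (\<psi> s) = G s" if "s \<in> S'" for s
    using that S1 N1 by (auto simp: S'_def)
  define H where "H = {p :: real \<times> (nat \<Rightarrow> real). fst p \<in> S' \<and> snd p = G (fst p)}"
  have H: "H \<in> sets borel"
  proof -
    have [measurable]: "G \<in> borel_measurable borel" "S' \<in> sets borel" by fact+
    have "Measurable.pred borel (\<lambda>p :: real \<times> (nat \<Rightarrow> real). fst p \<in> S' \<and> snd p = G (fst p))"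
      unfolding borel_prod[symmetric] by measurable
    then show ?thesis by (simp add: H_def pred_def)
  qed
  \<comment> \<open>\<open>j\<close> sends a point of the space to its place on the graph. Its image
    measure \<open>\<mu>\<close> is a finite Borel measure on a Polish space, so \<open>H\<close>
    can be approximated from inside by compact sets.\<close>
  define j where "j = (\<lambda>x. (f x, h x))"
  have j: "j \<in> borel_measurable M" unfolding j_def using f(1) h(1) by simp
  define \<mu> where "\<mu> = distr M borel j"
  interpret \<mu>: prob_space \<mu> unfolding \<mu>_def by (rule prob_space_distr[OF j])
  have \<mu>_eq: "emeasure \<mu> X = emeasure M (j -` X \<inter> space M)" if "X \<in> sets borel" for X
    using that j by (simp add: \<mu>_def emeasure_distr)
  have "AE x in M. x \<notin> f -` N1 \<inter> space M" "AE x in M. x \<notin> f -` N3 \<inter> space M"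
    by (intro AE_not_in f(2) N1 S1)+
  with \<psi>(2) AE_space have ae: "AE x in M. x \<in> A \<longrightarrow> j x \<in> H"
  proof eventually_elim
    case (elim x)
    show ?case
    proof
      assume "x \<in> A"
      with elim have "f x \<in> \<psi> -` A" by auto
      with elim S1 have "f x \<in> S'" by (auto simp: S'_def)
      with S'_A[OF this] elim show "j x \<in> H" by (auto simp: H_def j_def)
    qed
  qed
  have AH: "emeasure M A \<le> emeasure \<mu> H"
    using ae j H A by (subst \<mu>_eq) (auto intro!: emeasure_mono_AE measurable_sets)
  \<comment> \<open>Injectivity of \<open>h\<close> enters here: if \<open>h x = G s\<close> with
    \<open>s\<close> in \<open>S'\<close>, then \<open>\<psi> s\<close> is a point of
    \<open>A\<close> with the same value of \<open>h\<close>, so it is \<open>x\<close>.\<close>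
  have sub: "x \<in> A" if "K \<subseteq> H" "h x \<in> snd ` K" "x \<in> space M" for K x
  proof -
    from that obtain s where s: "s \<in> S'" "h x = G s" by (auto simp: H_def)
    have "\<psi> s \<in> A" "h (\<psi> s) = h x" using S'_A[OF s(1)] s by auto
    moreover have "\<psi> s \<in> space M" using \<open>\<psi> s \<in> A\<close> sets.sets_into_space[OF A] by auto
    ultimately show "x \<in> A" using inj_onD[OF h(2), of "\<psi> s" x] that by auto
  qed
  have inner: "emeasure \<mu> H = (SUP K\<in>{K. K \<subseteq> H \<and> compact K}. emeasure \<mu> K)"
    by (rule inner_regular) (use H \<mu>.emeasure_finite in \<open>auto simp: \<mu>_def\<close>)
  \<comment> \<open>If \<open>A\<close> has measure below \<open>1 / Suc n\<close>, the empty set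
    serves. Otherwise the difference of the two is nonnegative and can be handled in the reals
    before returning to \<open>ennreal\<close>.\<close>
  have "\<exists>K. K \<subseteq> H \<and> compact K \<and> emeasure M A < emeasure \<mu> K + ennreal (1 / Suc n)" for n
  proof (cases "emeasure M A < ennreal (1 / Suc n)")
    case True
    then show ?thesis by (intro exI[of _ "{}"]) auto
  next
    case False
    have "measure M A - 1 / Suc n < measure M A" by simp
    moreover have "0 \<le> measure M A - 1 / Suc n"
      using False by (simp add: emeasure_eq_measure ennreal_less_iff)
    ultimately have "ennreal (measure M A - 1 / Suc n) < emeasure M A"
      by (simp only: emeasure_eq_measure ennreal_less_iff)
    then have "ennreal (measure M A - 1 / Suc n) < emeasure \<mu> H"
      using AH by (rule less_le_trans)
    then obtain K where K: "K \<subseteq> H" "compact K" "ennreal (measure M A - 1 / Suc n) < emeasure \<mu> K"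
      unfolding inner less_SUP_iff by auto
    have "measure M A - 1 / Suc n < measure \<mu> K"
      using K(3) \<open>0 \<le> measure M A - 1 / Suc n\<close> by (simp add: \<mu>.emeasure_eq_measure ennreal_less_iff)
    then have "emeasure M A < emeasure \<mu> K + ennreal (1 / Suc n)"
      by (simp add: emeasure_eq_measure \<mu>.emeasure_eq_measure ennreal_less_iff flip: ennreal_plus)
    with K show ?thesis by auto
  qed
  then obtain K where K: "\<And>n. K n \<subseteq> H" "\<And>n. compact (K n)"
    "\<And>n. emeasure M A < emeasure \<mu> (K n) + ennreal (1 / Suc n)" by metis
  define T where "T = (\<Union>n. snd ` K n)"
  have T: "T \<in> sets borel"
  proof -
    have "snd ` K n \<in> sets borel" for n
      by (intro borel_compact compact_continuous_image[OF continuous_on_snd[OF continuous_on_id]] K(2))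
    then show ?thesis unfolding T_def by (intro sets.countable_UN) auto
  qed
  have TA: "h -` T \<inter> space M \<subseteq> A" using sub[OF K(1)] by (auto simp: T_def)
  have hT: "h -` T \<inter> space M \<in> sets M" using measurable_sets[OF h(1) T] .
  have "emeasure M A \<le> emeasure M (h -` T \<inter> space M)"
  proof (rule ennreal_le_epsilon)
    fix e :: real assume "0 < e"
    then obtain n where n: "1 / Suc n < e" by (meson nat_approx_posE)
    have "emeasure \<mu> (K n) \<le> emeasure M (h -` T \<inter> space M)"
      unfolding \<mu>_eq[OF borel_compact[OF K(2)]]
      by (rule emeasure_mono[OF _ hT]) (force simp: T_def j_def)
    moreover have "ennreal (1 / Suc n) \<le> ennreal e" using n by (intro ennreal_leI) simp
    ultimately show "emeasure M A \<le> emeasure M (h -` T \<inter> space M) + ennreal e"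
      using K(3)[of n] by (meson add_mono less_imp_le order_trans)
  qed
  then have "emeasure M (A - (h -` T \<inter> space M)) = 0"
    using TA hT A by (subst emeasure_Diff) (auto simp: emeasure_eq_measure intro!: diff_eq_0_ennreal)
  moreover have "A - (h -` T \<inter> space M) = A - h -` T" using sets.sets_into_space[OF A] by auto
  ultimately have "A - h -` T \<in> null_sets M" using A hT by (metis null_setsI sets.Diff)
  with T TA show thesis using that by blast
qed

section \<open>The neighborhood distance\<close>

text \<open>This is the L2 inner product of the neighborhood functions \<open>W x\<close> and
  \<open>W y\<close>; in particular \<open>k x x\<close> is a squared norm.\<close>

definition codegree :: "'a measure \<Rightarrow> ('a \<Rightarrow> 'a \<Rightarrow> real) \<Rightarrow> 'a \<Rightarrow> 'a \<Rightarrow> real" where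
  "codegree M W x y = (\<integral>u. W x u * W y u \<partial>M)"

locale pure_graphon_space =
  fixes M :: "'a measure" and W :: "'a \<Rightarrow> 'a \<Rightarrow> real"
  assumes pure: "pure_graphon M W"
begin

abbreviation "J \<equiv> space M"
abbreviation "r \<equiv> nbhd_dist M W"
abbreviation "r2 \<equiv> nbhd2_dist M W"
abbreviation "k \<equiv> codegree M W"

lemma standard: "standard_prob_space M"
  using pure by (simp add: pure_graphon_def graphon_def)

sublocale prob_space M
  using standard by (simp add: standard_prob_space_def)

sublocale complete_measure M
  by standard (use standard in \<open>auto simp: standard_prob_space_def\<close>)

sublocale R: Metric_space "space M" "nbhd_dist M W"
  using pure by (simp add: pure_graphon_def)

lemma r_complete: "R.mcomplete"
  using pure by (simp add: pure_graphon_def)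

lemma W_measurable: "x \<in> J \<Longrightarrow> W x \<in> borel_measurable M"
  and W_commute: "x \<in> J \<Longrightarrow> y \<in> J \<Longrightarrow> W x y = W y x"
  and W_nonneg: "x \<in> J \<Longrightarrow> y \<in> J \<Longrightarrow> 0 \<le> W x y"
  and W_le_1: "x \<in> J \<Longrightarrow> y \<in> J \<Longrightarrow> W x y \<le> 1"
  using pure by (auto simp: pure_graphon_def graphon_def)

lemma integrable_bounded:
  fixes f :: "'a \<Rightarrow> real"
  assumes "f \<in> borel_measurable M" "\<And>x. x \<in> J \<Longrightarrow> \<bar>f x\<bar> \<le> B"
  shows "integrable M f"
  by (rule integrable_const_bound[of _ B]) (use assms in auto)

lemma W_diff_abs_le_1: "x \<in> J \<Longrightarrow> y \<in> J \<Longrightarrow> u \<in> J \<Longrightarrow> \<bar>W x u - W y u\<bar> \<le> 1"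
  using W_nonneg[of x u] W_le_1[of x u] W_nonneg[of y u] W_le_1[of y u] by auto

lemma W_mult_le_1: "x \<in> J \<Longrightarrow> y \<in> J \<Longrightarrow> u \<in> J \<Longrightarrow> \<bar>W x u * W y u\<bar> \<le> 1"
  using W_nonneg[of x u] W_le_1[of x u] W_nonneg[of y u] W_le_1[of y u] by (simp add: mult_le_one)

lemma integrable_W_diff: "x \<in> J \<Longrightarrow> y \<in> J \<Longrightarrow> integrable M (\<lambda>u. \<bar>W x u - W y u\<bar>)"
  using W_measurable[of x] W_measurable[of y] W_diff_abs_le_1[of x y]
  by (intro integrable_bounded[of _ 1]) auto

lemma integrable_W_mult: "x \<in> J \<Longrightarrow> y \<in> J \<Longrightarrow> integrable M (\<lambda>u. W x u * W y u)"
  using W_measurable[of x] W_measurable[of y] W_mult_le_1[of x y]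
  by (intro integrable_bounded[of _ 1]) auto

lemma open_pos: "openin R.mtopology U \<Longrightarrow> U \<noteq> {} \<Longrightarrow> emeasure M U > 0"
  using pure by (auto simp: pure_graphon_def)

section \<open>Consequences of full support: measurability of open sets, density,
  separability\<close>

lemma open_measurable: "openin R.mtopology U \<Longrightarrow> U \<in> sets M"
  \<comment> \<open>By convention \<open>emeasure\<close> vanishes outside \<open>sets M\<close>, so
    the positive measure of a nonempty open set forces it to be measurable.\<close>
  using open_pos[of U] emeasure_notin_sets[of U M] by (cases "U = {}") fastforce+

text \<open>A ball of positive measure is not contained in a null set, so a property valid almost
  everywhere holds on an \<open>r\<close>-dense set. Lipschitz estimates can then spread it to all
  of \<open>J\<close>.\<close>

lemma AE_dense:
  assumes "AE z in M. P z" "x \<in> J" "0 < e"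
  obtains z where "z \<in> J" "r x z < e" "P z"
proof -
  have "R.mball x e \<notin> null_sets M"
    using open_pos[of "R.mball x e"] assms by (force simp: null_sets_def)
  then have "\<not> (AE z in M. z \<notin> R.mball x e)"
    using null_sets_iff_AE[of "R.mball x e"] R.mball_subset_mspace[of x e] by metis
  then have "\<exists>z. z \<in> R.mball x e \<and> P z"
    using assms(1) by (metis (mono_tags, lifting) eventually_mono)
  with that show thesis by auto
qed

text \<open>Balls of half the radius around separated points are disjoint and have positive measure,
  and a probability measure has room for only countably many of these.\<close>

lemma separated_imp_countable:
  assumes "0 < e" and D: "D \<subseteq> J" "\<And>x y. x \<in> D \<Longrightarrow> y \<in> D \<Longrightarrow> x \<noteq> y \<Longrightarrow> e \<le> r x y"
  shows "countable D"
proof -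
  let ?b = "\<lambda>x. R.mball x (e / 2)"
  have "sum (\<lambda>x. measure M (?b x)) F \<le> 1" if "finite F" "F \<subseteq> D" for F
  proof -
    have "disjoint_family_on ?b F"
      using that D R.disjoint_mball[of "e / 2" "e / 2"]
      by (force simp: disjoint_family_on_def disjnt_def subset_iff)
    then have "sum (\<lambda>x. measure M (?b x)) F = measure M (\<Union>x\<in>F. ?b x)"
      using that by (intro finite_measure_finite_Union[symmetric]) (auto intro: open_measurable)
    then show ?thesis by simp
  qed
  then have "(\<lambda>x. measure M (?b x)) summable_on D"
    by (intro nonneg_bounded_partial_sums_imp_summable_on[of _ _ 1]) (auto intro!: eventually_finite_subsets_at_top_weakI)
  then have "countable {x \<in> D. measure M (?b x) \<noteq> 0}" by (rule summable_countable_real)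
  moreover have "measure M (?b x) \<noteq> 0" if "x \<in> D" for x
    using open_pos[of "?b x"] that assms by (force simp: emeasure_eq_measure)
  ultimately show ?thesis by (metis (mono_tags, lifting) Collect_mem_eq Collect_cong)
qed

text \<open>Zorn's lemma gives a maximal \<open>e\<close>-separated set. Maximality makes it an
  \<open>e\<close>-net, and separation makes it countable.\<close>

lemma countable_net:
  assumes "0 < e"
  obtains D where "countable D" "D \<subseteq> J" "\<And>x. x \<in> J \<Longrightarrow> \<exists>y\<in>D. r x y < e"
proof -
  let ?A = "{D. D \<subseteq> J \<and> (\<forall>x\<in>D. \<forall>y\<in>D. x \<noteq> y \<longrightarrow> e \<le> r x y)}"
  have "\<Union>C \<in> ?A" if "subset.chain ?A C" for C
  proof -
    have sub: "C \<subseteq> ?A" and lin: "\<And>X Y. X \<in> C \<Longrightarrow> Y \<in> C \<Longrightarrow> X \<subseteq> Y \<or> Y \<subseteq> X"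
      using that unfolding subset_chain_def by (blast, blast)
    have sep: "e \<le> r x y" if xy: "x \<in> X" "X \<in> C" "y \<in> Y" "Y \<in> C" "x \<noteq> y" for x y X Y
    proof -
      obtain Z where Z: "Z \<in> C" "x \<in> Z" "y \<in> Z" using lin[of X Y] xy by blast
      have "Z \<in> ?A" using Z(1) sub by (rule subsetD[rotated])
      with Z(2,3) xy(5) show ?thesis by simp
    qed
    show ?thesis
    proof (intro CollectI conjI ballI impI)
      show "\<Union>C \<subseteq> J" using sub by auto
      fix x y assume "x \<in> \<Union>C" "y \<in> \<Union>C" and ne: "x \<noteq> y"
      then obtain X Y where "x \<in> X" "X \<in> C" "y \<in> Y" "Y \<in> C" by (elim UnionE)
      then show "e \<le> r x y" using ne by (rule sep)
    qed
  qed
  from subset_Zorn'[OF this] obtain D where D: "D \<in> ?A" "\<forall>X\<in>?A. D \<subseteq> X \<longrightarrow> X = D"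
    by (rule bexE)
  show thesis
  proof
    show "countable D" using separated_imp_countable[OF assms, of D] D(1) by auto
    show "D \<subseteq> J" using D(1) by auto
    fix x assume x: "x \<in> J"
    show "\<exists>y\<in>D. r x y < e"
    proof (rule ccontr)
      assume "\<not> ?thesis"
      then have far: "\<And>y. y \<in> D \<Longrightarrow> e \<le> r x y" by (metis not_le)
      have "e \<le> r y z" if yz: "y \<in> insert x D" "z \<in> insert x D" "y \<noteq> z" for y z
      proof -
        consider "y = x" "z \<in> D" | "z = x" "y \<in> D" | "y \<in> D" "z \<in> D" using yz by auto
        then show ?thesis
        proof cases
          case 2
          then show ?thesis using far[of y] R.commute[of y x] by simp
        qed (use far D(1) yz(3) in auto)
      qed
      then have "insert x D \<in> ?A" using D(1) x by auto
      then have "insert x D = D" by (rule D(2)[rule_format]) auto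
      then have "x \<in> D" by auto
      then show False using far[of x] x assms by simp
    qed
  qed
qed

lemma separable:
  obtains d :: "nat \<Rightarrow> 'a" where "range d \<subseteq> J" "\<And>x e. x \<in> J \<Longrightarrow> 0 < e \<Longrightarrow> \<exists>n. r x (d n) < e"
proof -
  have "\<exists>D. countable D \<and> D \<subseteq> J \<and> (\<forall>x\<in>J. \<exists>y\<in>D. r x y < 1 / Suc n)" for n
    by (rule countable_net[of "1 / Suc n"]) auto
  then obtain D where D: "\<And>n. countable (D n)" "\<And>n. D n \<subseteq> J"
    "\<And>n x. x \<in> J \<Longrightarrow> \<exists>y\<in>D n. r x y < 1 / Suc n" by metis
  let ?D = "\<Union>n. D n"
  obtain x0 where "x0 \<in> J" using not_empty by auto
  then have ne: "?D \<noteq> {}" using D(3)[of x0 0] by auto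
  have cnt: "countable ?D" using D by auto
  show thesis
  proof
    show "range (from_nat_into ?D) \<subseteq> J" using from_nat_into[OF ne] D(2) by blast
    fix x and e :: real assume x: "x \<in> J" and "0 < e"
    then obtain n where n: "1 / Suc n < e" by (meson nat_approx_posE)
    obtain y where "y \<in> D n" "r x y < 1 / Suc n" using D(3)[OF x] by blast
    moreover then obtain m where "from_nat_into ?D m = y"
      using from_nat_into_surj[OF cnt, of y] by blast
    ultimately show "\<exists>m. r x (from_nat_into ?D m) < e" using n by (metis less_trans)
  qed
qed

section \<open>Borel sets of the neighborhood distance\<close>

text \<open>Only the sigma-algebra matters here. It is kept apart from \<open>M\<close> because open
  sets generate \<open>Bor\<close> exactly, but \<open>sets M\<close> only up to null sets;
  arguments from open sets therefore pass through \<open>Bor\<close> first.\<close>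

definition Bor :: "'a measure" where
  "Bor = sigma J {U. openin R.mtopology U}"

lemma open_subset_J: "openin R.mtopology U \<Longrightarrow> U \<subseteq> J"
  using openin_subset by force

lemma space_Bor: "space Bor = J"
  and sets_Bor: "sets Bor = sigma_sets J {U. openin R.mtopology U}"
  using open_subset_J by (auto simp: Bor_def space_measure_of_conv intro!: sets_measure_of)

lemma open_Bor: "openin R.mtopology U \<Longrightarrow> U \<in> sets Bor"
  by (auto simp: sets_Bor)

lemma Bor_subset: "A \<in> sets Bor \<Longrightarrow> A \<in> sets M"
  using sets.sigma_sets_subset[of "{U. openin R.mtopology U}" M] open_measurable by (auto simp: sets_Bor)

lemma measurable_from_Bor: "f \<in> measurable Bor N \<Longrightarrow> f \<in> measurable M N"
  by (auto simp: measurable_def space_Bor Bor_subset)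

lemma measurable_to_Bor: "f \<in> measurable N M \<Longrightarrow> f \<in> measurable N Bor"
  by (auto simp: measurable_def space_Bor Bor_subset)

lemma lipschitz_measurable_Bor:
  fixes f :: "'a \<Rightarrow> real"
  assumes "\<And>x y. x \<in> J \<Longrightarrow> y \<in> J \<Longrightarrow> \<bar>f x - f y\<bar> \<le> r x y"
  shows "f \<in> borel_measurable Bor"
proof (rule borel_measurableI)
  fix S :: "real set" assume "open S"
  have "openin R.mtopology (f -` S \<inter> J)"
    unfolding R.openin_mtopology
  proof (intro conjI allI impI)
    fix x assume x: "x \<in> f -` S \<inter> J"
    then obtain e where e: "0 < e" "ball (f x) e \<subseteq> S" using \<open>open S\<close> openE by blast
    have "R.mball x e \<subseteq> f -` S \<inter> J"
      using assms[of x] e x by (force simp: dist_real_def)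
    with e show "\<exists>e>0. R.mball x e \<subseteq> f -` S \<inter> J" by auto
  qed auto
  then show "f -` S \<inter> space Bor \<in> sets Bor" by (simp add: space_Bor open_Bor)
qed

lemma lipschitz_measurable:
  fixes f :: "'a \<Rightarrow> real"
  assumes "\<And>x y. x \<in> J \<Longrightarrow> y \<in> J \<Longrightarrow> \<bar>f x - f y\<bar> \<le> r x y"
  shows "f \<in> borel_measurable M"
  by (rule measurable_from_Bor[OF lipschitz_measurable_Bor[OF assms]])

lemma r_lipschitz: "x \<in> J \<Longrightarrow> y \<in> J \<Longrightarrow> z \<in> J \<Longrightarrow> \<bar>r x z - r y z\<bar> \<le> r x y"
  using R.triangle[of x y z] R.triangle[of y x z] by (simp add: R.commute)

text \<open>The distances to a dense sequence determine a point, so they map \<open>J\<close>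
  injectively into the space of real sequences, by a function that is Borel for \<open>r\<close>.
  Preimages of Borel sets under this map lie in \<open>Bor\<close>, and on a standard space they
  exhaust \<open>sets M\<close> modulo null sets.\<close>

lemma Bor_inner:
  assumes "A \<in> sets M"
  obtains E where "E \<in> sets Bor" "E \<subseteq> A" "A - E \<in> null_sets M"
proof -
  obtain d where d: "range d \<subseteq> J" "\<And>x e. x \<in> J \<Longrightarrow> 0 < e \<Longrightarrow> \<exists>n :: nat. r x (d n) < e"
    using separable by metis
  define h where "h = (\<lambda>x n. r x (d n))"
  have dJ: "d n \<in> J" for n using d(1) by auto
  have h: "h \<in> borel_measurable Bor" unfolding h_def
    by (intro measurable_coordinatewise_then_product lipschitz_measurable_Bor r_lipschitz dJ)
  have inj: "inj_on h J"
  proof (rule inj_onI)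
    fix x y assume xy: "x \<in> J" "y \<in> J" and eq: "h x = h y"
    have "r x y \<le> 0 + e" if e: "0 < e" for e :: real
    proof -
      obtain n where n: "r x (d n) < e / 2" using d(2)[of x "e / 2"] xy e by auto
      moreover have "r y (d n) = r x (d n)" using fun_cong[OF eq, of n] by (simp add: h_def)
      ultimately show ?thesis using R.triangle[of x "d n" y] xy dJ[of n] by (simp add: R.commute)
    qed
    then have "r x y \<le> 0" by (rule field_le_epsilon)
    then show "x = y" using R.zero[of x y] R.nonneg[of x y] xy by linarith
  qed
  from inj_measurable_generates_mod_null[OF standard measurable_from_Bor[OF h] inj assms]
  obtain T where T: "T \<in> sets borel" "h -` T \<inter> J \<subseteq> A" "A - h -` T \<in> null_sets M" .
  have "A - (h -` T \<inter> J) = A - h -` T" using sets.sets_into_space[OF assms] by auto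
  with T measurable_sets[OF h T(1)] show thesis using that by (simp add: space_Bor)
qed

lemma measure_eq_on_Bor:
  assumes P: "finite_measure P" "sets P = sets Bor" and Q: "sets Q = sets Bor"
    and eq: "\<And>U. openin R.mtopology U \<Longrightarrow> emeasure P U = emeasure Q U"
  shows "P = Q"
proof (rule measure_eqI_generator_eq[of "{U. openin R.mtopology U}" J P Q "\<lambda>_. J"])
  show "Int_stable {U. openin R.mtopology U}" by (auto simp: Int_stable_def)
  show "emeasure P J \<noteq> \<infinity>" using finite_measure.emeasure_finite[OF P(1)] by simp
qed (use assms in \<open>auto simp: sets_Bor dest!: open_subset_J\<close>)

text \<open>Agreement on open sets extends to \<open>Bor\<close>. A set of \<open>sets M\<close>
  lies between two Borel sets of the same measure, so its preimage lies between measurable sets of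
  equal measure and is measurable because \<open>M\<close> is complete. Measurability with respect
  to \<open>M\<close> is thus obtained together with preservation.\<close>

lemma measure_preserving_if_open:
  assumes \<sigma>: "\<sigma> \<in> J \<rightarrow> J" and op: "\<And>U. openin R.mtopology U \<Longrightarrow> openin R.mtopology (\<sigma> -` U \<inter> J)"
    and eq: "\<And>U. openin R.mtopology U \<Longrightarrow> emeasure M (\<sigma> -` U \<inter> J) = emeasure M U"
  shows "\<sigma> \<in> measurable M M" "distr M M \<sigma> = M"
proof -
  have \<sigma>_Bor: "\<sigma> \<in> measurable M Bor"
    unfolding Bor_def
    by (rule measurable_sigma_sets[OF sets_measure_of]) (use open_subset_J op open_measurable \<sigma> in auto)
  have id_Bor: "(\<lambda>x. x) \<in> measurable M Bor" by (rule measurable_to_Bor) simp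
  interpret D: prob_space "distr M Bor \<sigma>" by (rule prob_space_distr[OF \<sigma>_Bor])
  have "distr M Bor \<sigma> = distr M Bor (\<lambda>x. x)"
  proof (rule measure_eq_on_Bor)
    fix U assume U: "openin R.mtopology U"
    then show "emeasure (distr M Bor \<sigma>) U = emeasure (distr M Bor (\<lambda>x. x)) U"
      using \<sigma>_Bor id_Bor eq[OF U] open_subset_J[OF U]
      by (simp add: emeasure_distr open_Bor Int_absorb2)
  qed (auto intro: D.finite_measure)
  then have eqB: "emeasure M (\<sigma> -` E \<inter> J) = emeasure M E" if "E \<in> sets Bor" for E
    using that emeasure_distr[OF \<sigma>_Bor that] emeasure_distr[OF id_Bor that] sets.sets_into_space[OF that]
    by (simp add: space_Bor Int_absorb2)
  have main: "\<sigma> -` A \<inter> J \<in> sets M \<and> emeasure M (\<sigma> -` A \<inter> J) = emeasure M A" if A: "A \<in> sets M" for A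
  proof -
    obtain E where E: "E \<in> sets Bor" "E \<subseteq> A" "A - E \<in> null_sets M" using Bor_inner[OF A] .
    obtain F where F: "F \<in> sets Bor" "F \<subseteq> J - A" "J - A - F \<in> null_sets M"
      using Bor_inner[of "J - A"] A by auto
    \<comment> \<open>The inner approximation \<open>F\<close> of the complement yields the outer
      approximation \<open>J - F\<close> of \<open>A\<close>.\<close>
    have F': "J - F \<in> sets Bor" using F(1) sets.compl_sets[of F Bor] by (simp add: space_Bor)
    have EM: "emeasure M E = emeasure M A"
      using emeasure_Un_null_set[of E M "A - E"] E Bor_subset[OF E(1)] by (simp add: Un_absorb1)
    have "A \<union> (J - A - F) = J - F" using F(2) sets.sets_into_space[OF A] by auto
    then have FM: "emeasure M (J - F) = emeasure M A"
      using emeasure_Un_null_set[OF A F(3)] by simp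
    have ms: "\<sigma> -` E \<inter> J \<in> sets M" "\<sigma> -` (J - F) \<inter> J \<in> sets M"
      using measurable_sets[OF \<sigma>_Bor] E F' by auto
    have sub: "\<sigma> -` E \<inter> J \<subseteq> \<sigma> -` A \<inter> J" "\<sigma> -` A \<inter> J \<subseteq> \<sigma> -` (J - F) \<inter> J"
      using E F \<sigma> by auto
    have me: "emeasure M (\<sigma> -` E \<inter> J) = emeasure M A" "emeasure M (\<sigma> -` (J - F) \<inter> J) = emeasure M A"
      using eqB E F' EM FM by auto
    have fin: "emeasure M (\<sigma> -` E \<inter> J) < \<infinity>"
      by (metis emeasure_finite infinity_ennreal_def less_top)
    have m: "\<sigma> -` A \<inter> J \<in> sets M"
      by (rule complete_sets_sandwich[OF ms sub _ fin]) (simp only: me)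
    moreover have "emeasure M (\<sigma> -` A \<inter> J) = emeasure M A"
      by (rule antisym[OF emeasure_mono[OF sub(2) ms(2), unfolded me] emeasure_mono[OF sub(1) m, unfolded me]])
    ultimately show ?thesis by simp
  qed
  show m: "\<sigma> \<in> measurable M M"
  proof (rule measurableI)
    show "\<sigma> x \<in> J" if "x \<in> J" for x using \<sigma> that by (rule funcset_mem)
    show "\<sigma> -` A \<inter> J \<in> sets M" if "A \<in> sets M" for A using main[OF that] by (rule conjunct1)
  qed
  show "distr M M \<sigma> = M"
  proof (rule measure_eqI)
    fix A assume "A \<in> sets (distr M M \<sigma>)"
    then have "A \<in> sets M" by simp
    then show "emeasure (distr M M \<sigma>) A = emeasure M A" using main[of A] by (simp add: emeasure_distr[OF m])
  qed simp
qed

text \<open>The measures with densities \<open>f\<close> and \<open>g\<close> agree on open sets,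
  hence on \<open>Bor\<close>, hence on \<open>sets M\<close>, since both vanish on null sets of
  \<open>M\<close>. Uniqueness of densities concludes.\<close>

lemma AE_eq_if_open:
  fixes f g :: "'a \<Rightarrow> real"
  assumes f: "f \<in> borel_measurable M" "\<And>x. x \<in> J \<Longrightarrow> 0 \<le> f x \<and> f x \<le> 1"
    and g: "g \<in> borel_measurable M" "\<And>x. x \<in> J \<Longrightarrow> 0 \<le> g x \<and> g x \<le> 1"
    and eq: "\<And>U. openin R.mtopology U \<Longrightarrow>
      (\<integral>\<^sup>+x\<in>U. ennreal (f x) \<partial>M) = (\<integral>\<^sup>+x\<in>U. ennreal (g x) \<partial>M)"
  shows "AE x in M. f x = g x"
proof -
  let ?P = "density M (\<lambda>x. ennreal (f x))" and ?Q = "density M (\<lambda>x. ennreal (g x))"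
  have id_Bor: "(\<lambda>x. x) \<in> measurable M Bor" by (rule measurable_to_Bor) simp
  have fm: "(\<lambda>x. ennreal (f x)) \<in> borel_measurable M" "(\<lambda>x. ennreal (g x)) \<in> borel_measurable M"
    using f(1) g(1) by auto
  have le1: "(\<integral>\<^sup>+x. ennreal (f x) \<partial>M) \<le> 1"
    using nn_integral_mono[of M "\<lambda>x. ennreal (f x)" "\<lambda>_. 1"] f(2) emeasure_space_1
    by (auto simp: ennreal_le_1)
  have fin: "(\<integral>\<^sup>+x. ennreal (f x) \<partial>M) \<noteq> \<infinity>" using le1 by (auto simp: top_unique)
  have P: "finite_measure ?P"
    by (rule finite_measureI) (use fm fin in \<open>simp add: emeasure_density\<close>)
  have idB: "(\<lambda>x. x) \<in> measurable ?P Bor" "(\<lambda>x. x) \<in> measurable ?Q Bor" using id_Bor by auto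
  have "distr ?P Bor (\<lambda>x. x) = distr ?Q Bor (\<lambda>x. x)"
  proof (rule measure_eq_on_Bor)
    show "finite_measure (distr ?P Bor (\<lambda>x. x))"
      by (rule finite_measure.finite_measure_distr[OF P idB(1)])
    fix U assume U: "openin R.mtopology U"
    then show "emeasure (distr ?P Bor (\<lambda>x. x)) U = emeasure (distr ?Q Bor (\<lambda>x. x)) U"
      using idB eq[OF U] open_subset_J[OF U] fm open_measurable[OF U]
      by (simp add: emeasure_distr open_Bor Int_absorb2 emeasure_density)
  qed auto
  then have eqB: "emeasure ?P E = emeasure ?Q E" if "E \<in> sets Bor" for E
    using that emeasure_distr[OF idB(1) that] emeasure_distr[OF idB(2) that] sets.sets_into_space[OF that]
    by (simp add: space_Bor Int_absorb2)
  have null: "N \<in> null_sets ?P" "N \<in> null_sets ?Q" if "N \<in> null_sets M" for N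
    using that fm by (auto simp: null_sets_density_iff intro: AE_mp[OF AE_not_in])
  have "?P = ?Q"
  proof (rule measure_eqI)
    fix A assume "A \<in> sets ?P"
    then have A: "A \<in> sets M" by simp
    obtain E where E: "E \<in> sets Bor" "E \<subseteq> A" "A - E \<in> null_sets M" using Bor_inner[OF A] .
    have "A = E \<union> (A - E)" using E by auto
    then show "emeasure ?P A = emeasure ?Q A"
      using emeasure_Un_null_set[of E ?P "A - E"] emeasure_Un_null_set[of E ?Q "A - E"]
        null[OF E(3)] Bor_subset[OF E(1)] eqB[OF E(1)] by simp
  qed simp
  then have "AE x in M. ennreal (f x) = ennreal (g x)"
    using density_unique_iff[OF fm] by simp
  then show ?thesis
    using AE_space by eventually_elim (use f(2) g(2) in auto)
qed

end

text \<open>Here \<open>c\<close> is a coloring with finitely many colors and small color classes;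
  one representative of each color gives the net. Total boundedness of \<open>J\<close> under
  \<open>r2\<close> and of the group are both obtained in this way.\<close>

lemma finite_image_imp_finite_net:
  fixes d :: "'a \<Rightarrow> 'a \<Rightarrow> real"
  assumes "finite (c ` S)" "\<And>x y. x \<in> S \<Longrightarrow> y \<in> S \<Longrightarrow> c x = c y \<Longrightarrow> d x y < e"
  obtains F where "finite F" "F \<subseteq> S" "\<And>x. x \<in> S \<Longrightarrow> \<exists>y\<in>F. d y x < e"
proof
  let ?F = "inv_into S c ` (c ` S)"
  show "finite ?F" using assms(1) by simp
  show "?F \<subseteq> S" by (auto intro: inv_into_into)
  fix x assume x: "x \<in> S"
  have "d (inv_into S c (c x)) x < e"
    using x by (intro assms(2)) (auto simp: f_inv_into_f intro: inv_into_into)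
  then show "\<exists>y\<in>?F. d y x < e" using x by auto
qed

lemma floor_divide_eq_imp_close:
  fixes a b e :: real
  assumes "\<lfloor>a / e\<rfloor> = \<lfloor>b / e\<rfloor>" "0 < e"
  shows "\<bar>a - b\<bar> < e"
proof -
  have "\<bar>a / e - b / e\<bar> < 1" using assms(1) by linarith
  then show ?thesis using assms(2) by (simp add: diff_divide_distrib[symmetric] abs_divide)
qed

context pure_graphon_space
begin

section \<open>The 2-neighborhood distance\<close>

lemma codegree_commute: "k x y = k y x"
  by (simp add: codegree_def mult.commute)

lemma codegree_diff:
  assumes "x \<in> J" "y \<in> J" "z \<in> J"
  shows "k x z - k y z = (\<integral>u. (W x u - W y u) * W z u \<partial>M)"
  using integrable_W_mult assms by (simp add: codegree_def left_diff_distrib)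

lemma codegree_lipschitz:
  assumes "x \<in> J" "y \<in> J" "z \<in> J"
  shows "\<bar>k x z - k y z\<bar> \<le> r x y"
proof -
  have int: "integrable M (\<lambda>u. (W x u - W y u) * W z u)"
    using integrable_W_mult assms by (simp add: left_diff_distrib)
  have "\<bar>k x z - k y z\<bar> \<le> (\<integral>u. \<bar>(W x u - W y u) * W z u\<bar> \<partial>M)"
    unfolding codegree_diff[OF assms] by (rule integral_abs_bound)
  also have "\<dots> \<le> (\<integral>u. \<bar>W x u - W y u\<bar> \<partial>M)"
    using assms
    by (intro integral_mono[OF integrable_abs[OF int] integrable_W_diff])
      (auto simp: abs_mult W_nonneg W_le_1 intro!: mult_left_le)
  finally show ?thesis by (simp add: nbhd_dist_def)
qed

lemma codegree_lipschitz2: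
  "x \<in> J \<Longrightarrow> y \<in> J \<Longrightarrow> z \<in> J \<Longrightarrow> \<bar>k x y - k x z\<bar> \<le> r y z"
  using codegree_lipschitz[of y z x] by (simp add: codegree_commute)

lemma codegree_measurable: "x \<in> J \<Longrightarrow> k x \<in> borel_measurable M"
  by (rule lipschitz_measurable[OF codegree_lipschitz2])

lemma r_le_1: "x \<in> J \<Longrightarrow> y \<in> J \<Longrightarrow> r x y \<le> 1"
  unfolding nbhd_dist_def
  by (intro integral_le_const integrable_W_diff AE_I2 W_diff_abs_le_1)

lemma codegree_diff_le_1: "x \<in> J \<Longrightarrow> y \<in> J \<Longrightarrow> z \<in> J \<Longrightarrow> \<bar>k x z - k y z\<bar> \<le> 1"
  using codegree_lipschitz[of x y z] r_le_1[of x y] by linarith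

lemma integrable_codegree_diff: "x \<in> J \<Longrightarrow> y \<in> J \<Longrightarrow> integrable M (\<lambda>z. \<bar>k x z - k y z\<bar>)"
  using codegree_measurable[of x] codegree_measurable[of y] codegree_diff_le_1[of x y]
  by (intro integrable_bounded[of _ 1]) auto

lemma nbhd2_dist_eq:
  assumes "x \<in> J" "y \<in> J"
  shows "r2 x y = (\<integral>z. \<bar>k x z - k y z\<bar> \<partial>M)"
  unfolding nbhd2_dist_def
proof (rule Bochner_Integration.integral_cong[OF refl])
  fix z assume z: "z \<in> J"
  have "(\<integral>u. (W x u - W y u) * W u z \<partial>M) = (\<integral>u. (W x u - W y u) * W z u \<partial>M)"
    using z by (intro Bochner_Integration.integral_cong) (auto simp: W_commute)
  then show "\<bar>\<integral>u. (W x u - W y u) * W u z \<partial>M\<bar> = \<bar>k x z - k y z\<bar>"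
    using codegree_diff assms z by simp
qed

lemma integral_W_diff_sq:
  assumes "x \<in> J" "y \<in> J"
  shows "(\<integral>u. (W x u - W y u)\<^sup>2 \<partial>M) = k x x - 2 * k x y + k y y"
proof -
  have "(\<integral>u. (W x u - W y u)\<^sup>2 \<partial>M)
      = (\<integral>u. W x u * W x u - 2 * (W x u * W y u) + W y u * W y u \<partial>M)"
    by (simp add: power2_eq_square algebra_simps)
  also have "\<dots> = k x x - 2 * k x y + k y y"
    using integrable_W_mult assms by (simp add: codegree_def)
  finally show ?thesis .
qed

text \<open>On a probability space the square of the L1 norm is at most the square of the L2 norm,
  because the variance is nonnegative; the latter expands into codegrees.\<close>

lemma r_sq_le:
  assumes "x \<in> J" "y \<in> J"
  shows "(r x y)\<^sup>2 \<le> k x x - 2 * k x y + k y y"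
proof -
  have m: "(\<lambda>u. (W x u - W y u)\<^sup>2) \<in> borel_measurable M"
    using W_measurable assms by measurable
  have "integrable M (\<lambda>u. \<bar>W x u - W y u\<bar>\<^sup>2)"
    using m W_diff_abs_le_1[OF assms]
    by (intro integrable_bounded[of _ 1]) (auto simp: abs_square_le_1)
  from variance_eq[OF integrable_W_diff[OF assms] this] variance_positive[of "\<lambda>u. \<bar>W x u - W y u\<bar>"]
  show ?thesis by (simp add: nbhd_dist_def integral_W_diff_sq[OF assms])
qed

text \<open>Vanishing of \<open>r2\<close> gives equality of \<open>k x\<close> and
  \<open>k y\<close> almost everywhere, and by density and Lipschitz continuity everywhere.
  Evaluating at \<open>x\<close> and at \<open>y\<close> makes the bound of \<open>r_sq_le\<close>
  zero.\<close>

lemma nbhd2_dist_eq_0_imp_eq: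
  assumes x: "x \<in> J" and y: "y \<in> J" and 0: "r2 x y = 0"
  shows "x = y"
proof -
  have "AE z in M. \<bar>k x z - k y z\<bar> = 0"
    using 0 integral_nonneg_eq_0_iff_AE[OF integrable_codegree_diff[OF x y]]
    by (simp add: nbhd2_dist_eq[OF x y])
  then have ae: "AE z in M. k x z = k y z" by simp
  have eq: "k x z = k y z" if z: "z \<in> J" for z
  proof -
    have "\<bar>k x z - k y z\<bar> \<le> 0 + e" if e: "0 < e" for e
    proof -
      obtain z' where z': "z' \<in> J" "r z z' < e / 2" "k x z' = k y z'"
        using AE_dense[OF ae z, of "e / 2"] e by auto
      then show ?thesis
        using codegree_lipschitz2[OF x z z'(1)] codegree_lipschitz2[OF y z z'(1)] by linarith
    qed
    then have "\<bar>k x z - k y z\<bar> \<le> 0" by (rule field_le_epsilon)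
    then show ?thesis by simp
  qed
  have "(r x y)\<^sup>2 \<le> 0"
    using r_sq_le[OF x y] eq[OF x] eq[OF y] codegree_commute[of x y] by simp
  then show ?thesis using R.zero[OF x y] by simp
qed

sublocale R2: Metric_space "space M" "nbhd2_dist M W"
proof
  show "0 \<le> r2 x y" for x y by (simp add: nbhd2_dist_def)
  \<comment> \<open>Symmetry is required also for arguments off \<open>J\<close>, where
    \<open>nbhd2_dist_eq\<close> does not apply; it is therefore read off the definition.\<close>
  show "r2 x y = r2 y x" for x y
  proof -
    have "(\<integral>u. (W x u - W y u) * W u z \<partial>M) = - (\<integral>u. (W y u - W x u) * W u z \<partial>M)" for z
      by (subst Bochner_Integration.integral_minus[symmetric]) (simp add: algebra_simps)
    then show ?thesis by (simp add: nbhd2_dist_def)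
  qed
  show "r2 x y = 0 \<longleftrightarrow> x = y" if "x \<in> J" "y \<in> J" for x y
    using nbhd2_dist_eq_0_imp_eq[OF that] by (auto simp: nbhd2_dist_def)
  show "r2 x z \<le> r2 x y + r2 y z" if xyz: "x \<in> J" "y \<in> J" "z \<in> J" for x y z
  proof -
    have "r2 x z \<le> (\<integral>u. \<bar>k x u - k y u\<bar> + \<bar>k y u - k z u\<bar> \<partial>M)"
      unfolding nbhd2_dist_eq[OF xyz(1,3)]
      by (intro integral_mono integrable_codegree_diff Bochner_Integration.integrable_add xyz) simp
    also have "\<dots> = r2 x y + r2 y z"
      using xyz by (simp add: nbhd2_dist_eq integrable_codegree_diff)
    finally show ?thesis .
  qed
qed

lemma nbhd2_dist_le_1: "x \<in> J \<Longrightarrow> y \<in> J \<Longrightarrow> r2 x y \<le> 1"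
  by (simp only: nbhd2_dist_eq)
    (intro integral_le_const integrable_codegree_diff AE_I2 codegree_diff_le_1)

lemma codegree_nonneg: "x \<in> J \<Longrightarrow> y \<in> J \<Longrightarrow> 0 \<le> k x y"
  unfolding codegree_def
  by (rule Bochner_Integration.integral_nonneg) (simp add: W_nonneg)

lemma codegree_le_1: "x \<in> J \<Longrightarrow> y \<in> J \<Longrightarrow> k x y \<le> 1"
  unfolding codegree_def
  by (intro integral_le_const integrable_W_mult AE_I2) (auto intro: order_trans[OF abs_ge_self W_mult_le_1])

section \<open>Total boundedness of the 2-neighborhood distance\<close>

lemma finite_balls_almost_cover:
  assumes "0 < e"
  obtains F where "finite F" "F \<subseteq> J" "prob (J - (\<Union>x\<in>F. R.mball x e)) < e"
proof -
  obtain d where d: "range d \<subseteq> J" "\<And>x e. x \<in> J \<Longrightarrow> 0 < e \<Longrightarrow> \<exists>n :: nat. r x (d n) < e"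
    using separable by metis
  have dJ: "d n \<in> J" for n using d(1) by auto
  let ?U = "\<lambda>n. \<Union>i<n. R.mball (d i) e"
  have U: "?U n \<in> sets M" for n by (intro sets.countable_UN') (auto intro: open_measurable)
  \<comment> \<open>Balls around a dense sequence cover \<open>J\<close>, so by continuity from
    below finitely many of them miss only a set of small measure. A full finite cover cannot be
    expected, as \<open>r\<close> need not be totally bounded.\<close>
  have "(\<Union>n. ?U n) = J"
  proof
    show "J \<subseteq> (\<Union>n. ?U n)"
    proof
      fix x assume x: "x \<in> J"
      then obtain n where "r x (d n) < e" using d(2) assms by blast
      then have "x \<in> ?U (Suc n)" using x dJ by (auto simp: R.commute)
      then show "x \<in> (\<Union>n. ?U n)" by blast
    qed
  qed auto
  moreover have "(\<lambda>n. prob (?U n)) \<longlonglongrightarrow> prob (\<Union>n. ?U n)"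
    by (rule finite_Lim_measure_incseq) (use U in blast, force intro!: incseq_SucI)
  ultimately have "(\<lambda>n. prob (?U n)) \<longlonglongrightarrow> 1" by (simp add: prob_space)
  then have "eventually (\<lambda>n. 1 - e < prob (?U n)) sequentially"
    using assms by (auto intro: order_tendstoD)
  then obtain n where "1 - e < prob (?U n)" by (auto simp: eventually_sequentially)
  then have "prob (J - ?U n) < e" using prob_compl[OF U[of n]] by linarith
  then have "prob (J - (\<Union>x\<in>d ` {..<n}. R.mball x e)) < e" by (simp only: image_image)
  moreover have "d ` {..<n} \<subseteq> J" using dJ by blast
  ultimately show thesis using that[OF finite_imageI[OF finite_lessThan]] by blast
qed

text \<open>The color of \<open>x\<close> lists its codegrees with the finitely many ball centers,
  rounded to multiples of \<open>\<delta>\<close>. Points of the same color have codegrees within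
  \<open>3 * \<delta>\<close> on the covered part of \<open>J\<close> and within \<open>1\<close> on
  the rest \<open>B\<close>, of measure below \<open>\<delta>\<close>; so their \<open>r2\<close>
  distance is below \<open>4 * \<delta>\<close>, less than \<open>e\<close>.\<close>

lemma nbhd2_dist_finite_net:
  assumes e: "0 < e"
  obtains F where "finite F" "F \<subseteq> J" "\<And>x. x \<in> J \<Longrightarrow> \<exists>y\<in>F. r2 y x < e"
proof -
  define \<delta> where "\<delta> = e / 5"
  have \<delta>: "0 < \<delta>" using e by (simp add: \<delta>_def)
  obtain F where F: "finite F" "F \<subseteq> J" "prob (J - (\<Union>x\<in>F. R.mball x \<delta>)) < \<delta>"
    using finite_balls_almost_cover[OF \<delta>] .
  define B where "B = J - (\<Union>x\<in>F. R.mball x \<delta>)"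
  have B: "B \<in> sets M" unfolding B_def
    using F by (intro sets.Diff sets.finite_UN) (auto intro: open_measurable)
  define c where "c x = (\<lambda>w\<in>F. \<lfloor>k x w / \<delta>\<rfloor>)" for x
  have "c x \<in> F \<rightarrow>\<^sub>E {0..\<lfloor>1 / \<delta>\<rfloor>}" if x: "x \<in> J" for x
    using codegree_nonneg[OF x] codegree_le_1[OF x] F \<delta>
    by (auto simp: c_def subset_iff intro!: floor_mono divide_right_mono)
  then have "c ` J \<subseteq> F \<rightarrow>\<^sub>E {0..\<lfloor>1 / \<delta>\<rfloor>}" by auto
  then have fin: "finite (c ` J)"
    by (rule finite_subset) (intro finite_PiE F finite_atLeastAtMost_int)
  have close: "r2 x y < e" if x: "x \<in> J" and y: "y \<in> J" and eq: "c x = c y" for x y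
  proof -
    have "\<bar>k x z - k y z\<bar> \<le> 3 * \<delta> + indicator B z" if z: "z \<in> J" for z
    proof (cases "z \<in> B")
      case True
      then show ?thesis using codegree_diff_le_1[OF x y z] \<delta> by simp
    next
      case False
      then obtain w where w: "w \<in> F" "w \<in> J" "r w z < \<delta>" using z F by (auto simp: B_def)
      have "\<lfloor>k x w / \<delta>\<rfloor> = \<lfloor>k y w / \<delta>\<rfloor>" using fun_cong[OF eq, of w] w by (simp add: c_def)
      then have "\<bar>k x w - k y w\<bar> < \<delta>" using \<delta> by (rule floor_divide_eq_imp_close)
      then show ?thesis
        using codegree_lipschitz2[OF x w(2) z] codegree_lipschitz2[OF y w(2) z] w(3) False by simp
    qed
    then have "r2 x y \<le> (\<integral>z. 3 * \<delta> + indicator B z \<partial>M)"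
      unfolding nbhd2_dist_eq[OF x y] using B
      by (intro integral_mono integrable_codegree_diff x y Bochner_Integration.integrable_add)
        (auto simp: emeasure_eq_measure)
    also have "\<dots> = 3 * \<delta> + prob B"
      using B sets.sets_into_space[OF B]
      by (subst Bochner_Integration.integral_add) (auto simp: emeasure_eq_measure prob_space Int_absorb1 Int_absorb2)
    also have "\<dots> < e" using F(3) e by (simp add: B_def \<delta>_def)
    finally show ?thesis .
  qed
  show thesis by (rule finite_image_imp_finite_net[of c J r2 e, OF fin], erule (2) close, rule that)
qed

section \<open>Automorphisms\<close>

abbreviation "Aut \<equiv> graphon_auto M W"

lemma Aut_Bij: "\<sigma> \<in> Aut \<Longrightarrow> \<sigma> \<in> Bij J"
  and Aut_measurable: "\<sigma> \<in> Aut \<Longrightarrow> \<sigma> \<in> measurable M M"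
  and Aut_distr: "\<sigma> \<in> Aut \<Longrightarrow> distr M M \<sigma> = M"
  and Aut_AE_W: "\<sigma> \<in> Aut \<Longrightarrow> x \<in> J \<Longrightarrow> AE y in M. W (\<sigma> x) (\<sigma> y) = W x y"
  by (auto simp: graphon_auto_def)

lemma Aut_bij_betw: "\<sigma> \<in> Aut \<Longrightarrow> bij_betw \<sigma> J J"
  using Aut_Bij by (simp add: Bij_def)

lemma Aut_closed: "\<sigma> \<in> Aut \<Longrightarrow> x \<in> J \<Longrightarrow> \<sigma> x \<in> J"
  using Aut_measurable measurable_space by metis

lemma Aut_eqI:
  assumes "\<sigma> \<in> Aut" "\<tau> \<in> Aut" "\<And>x. x \<in> J \<Longrightarrow> \<sigma> x = \<tau> x"
  shows "\<sigma> = \<tau>"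
  using assms Bij_imp_extensional[OF Aut_Bij] by (meson extensionalityI)

section \<open>Invariance of both distances and of codegrees under automorphisms\<close>

lemma measure_preserving_integral:
  fixes f :: "'a \<Rightarrow> real"
  assumes "\<sigma> \<in> measurable M M" "distr M M \<sigma> = M" "f \<in> borel_measurable M"
  shows "(\<integral>x. f (\<sigma> x) \<partial>M) = (\<integral>x. f x \<partial>M)"
  using integral_distr[OF assms(1,3)] assms(2) by simp

lemma measure_preserving_AE:
  assumes "\<sigma> \<in> measurable M M" "distr M M \<sigma> = M" "AE y in M. P y"
  shows "AE y in M. P (\<sigma> y)"
proof -
  have "AE y in distr M M \<sigma>. P y" unfolding assms(2) by (rule assms(3))
  then show ?thesis by (rule AE_distrD[OF assms(1)])
qed

lemma Aut_r:
  assumes \<sigma>: "\<sigma> \<in> Aut" and xy: "x \<in> J" "y \<in> J"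
  shows "r (\<sigma> x) (\<sigma> y) = r x y"
proof -
  have m: "(\<lambda>z. \<bar>W (\<sigma> x) z - W (\<sigma> y) z\<bar>) \<in> borel_measurable M"
    using W_measurable[OF Aut_closed[OF \<sigma>]] xy by measurable
  have "r (\<sigma> x) (\<sigma> y) = (\<integral>z. \<bar>W (\<sigma> x) (\<sigma> z) - W (\<sigma> y) (\<sigma> z)\<bar> \<partial>M)"
    unfolding nbhd_dist_def
    by (rule measure_preserving_integral[OF Aut_measurable[OF \<sigma>] Aut_distr[OF \<sigma>] m, symmetric])
  also have "\<dots> = r x y"
    unfolding nbhd_dist_def
    by (intro integral_cong_AE measurable_compose[OF Aut_measurable[OF \<sigma>] m]
        borel_measurable_integrable[OF integrable_W_diff] xy)
      (use Aut_AE_W[OF \<sigma> xy(1)] Aut_AE_W[OF \<sigma> xy(2)] in \<open>auto\<close>)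
  finally show ?thesis .
qed

lemma Aut_codegree:
  assumes \<sigma>: "\<sigma> \<in> Aut" and xy: "x \<in> J" "y \<in> J"
  shows "k (\<sigma> x) (\<sigma> y) = k x y"
proof -
  have m: "(\<lambda>z. W (\<sigma> x) z * W (\<sigma> y) z) \<in> borel_measurable M"
    using W_measurable[OF Aut_closed[OF \<sigma>]] xy by measurable
  have "k (\<sigma> x) (\<sigma> y) = (\<integral>z. W (\<sigma> x) (\<sigma> z) * W (\<sigma> y) (\<sigma> z) \<partial>M)"
    unfolding codegree_def
    by (rule measure_preserving_integral[OF Aut_measurable[OF \<sigma>] Aut_distr[OF \<sigma>] m, symmetric])
  also have "\<dots> = k x y"
    unfolding codegree_def
    by (intro integral_cong_AE measurable_compose[OF Aut_measurable[OF \<sigma>] m]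
        borel_measurable_integrable[OF integrable_W_mult] xy)
      (use Aut_AE_W[OF \<sigma> xy(1)] Aut_AE_W[OF \<sigma> xy(2)] in \<open>auto\<close>)
  finally show ?thesis .
qed

lemma Aut_r2:
  assumes \<sigma>: "\<sigma> \<in> Aut" and xy: "x \<in> J" "y \<in> J"
  shows "r2 (\<sigma> x) (\<sigma> y) = r2 x y"
proof -
  have m: "(\<lambda>z. \<bar>k (\<sigma> x) z - k (\<sigma> y) z\<bar>) \<in> borel_measurable M"
    using codegree_measurable[OF Aut_closed[OF \<sigma>]] xy by measurable
  have "r2 (\<sigma> x) (\<sigma> y) = (\<integral>z. \<bar>k (\<sigma> x) (\<sigma> z) - k (\<sigma> y) (\<sigma> z)\<bar> \<partial>M)"
    unfolding nbhd2_dist_eq[OF Aut_closed[OF \<sigma> xy(1)] Aut_closed[OF \<sigma> xy(2)]]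
    by (rule measure_preserving_integral[OF Aut_measurable[OF \<sigma>] Aut_distr[OF \<sigma>] m, symmetric])
  also have "\<dots> = r2 x y"
    unfolding nbhd2_dist_eq[OF xy]
    by (intro Bochner_Integration.integral_cong) (use Aut_codegree[OF \<sigma>] xy in auto)
  finally show ?thesis .
qed

lemma isometry_vimage_open:
  assumes \<sigma>: "\<sigma> \<in> J \<rightarrow> J" "\<And>x y. x \<in> J \<Longrightarrow> y \<in> J \<Longrightarrow> r (\<sigma> x) (\<sigma> y) = r x y"
    and U: "openin R.mtopology U"
  shows "openin R.mtopology (\<sigma> -` U \<inter> J)"
  unfolding R.openin_mtopology
proof (intro conjI allI impI)
  fix x assume x: "x \<in> \<sigma> -` U \<inter> J"
  then obtain e where e: "0 < e" "R.mball (\<sigma> x) e \<subseteq> U" using U by (auto simp: R.openin_mtopology)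
  have "R.mball x e \<subseteq> \<sigma> -` U \<inter> J"
  proof
    fix y assume "y \<in> R.mball x e"
    then have "\<sigma> y \<in> R.mball (\<sigma> x) e" "y \<in> J" using \<sigma>(2)[of x y] funcset_mem[OF \<sigma>(1)] by auto
    then show "y \<in> \<sigma> -` U \<inter> J" using e by auto
  qed
  with e show "\<exists>e>0. R.mball x e \<subseteq> \<sigma> -` U \<inter> J" by auto
qed auto

section \<open>Inverses, composition and the group structure\<close>

abbreviation "inv_map \<sigma> \<equiv> restrict (inv_into J \<sigma>) J"

lemma Aut_inv_right: "\<sigma> \<in> Aut \<Longrightarrow> x \<in> J \<Longrightarrow> \<sigma> (inv_map \<sigma> x) = x"
  using bij_betw_inv_into_right[OF Aut_bij_betw] by simp

lemma Aut_inv_left: "\<sigma> \<in> Aut \<Longrightarrow> x \<in> J \<Longrightarrow> inv_map \<sigma> (\<sigma> x) = x"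
  using bij_betw_inv_into_left[OF Aut_bij_betw] Aut_closed by simp

text \<open>The definition of an automorphism says nothing about measurability of its inverse. The
  inverse is an isometry for \<open>r\<close>, so it pulls open sets back to open sets, and
  \<open>\<sigma>\<close> itself shows that their measure is unchanged;
  \<open>measure_preserving_if_open\<close> then applies.\<close>

lemma Aut_inv:
  assumes \<sigma>: "\<sigma> \<in> Aut"
  shows "inv_map \<sigma> \<in> Aut"
proof -
  have B: "inv_map \<sigma> \<in> Bij J" by (rule restrict_inv_into_Bij[OF Aut_Bij[OF \<sigma>]])
  have fs: "inv_map \<sigma> \<in> J \<rightarrow> J" by (rule Bij_imp_funcset[OF B])
  have iso: "r (inv_map \<sigma> x) (inv_map \<sigma> y) = r x y" if "x \<in> J" "y \<in> J" for x y
    using Aut_r[OF \<sigma> funcset_mem[OF fs that(1)] funcset_mem[OF fs that(2)]]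
    by (simp only: Aut_inv_right[OF \<sigma>] that)
  have op: "openin R.mtopology (inv_map \<sigma> -` U \<inter> J)" if "openin R.mtopology U" for U
    by (rule isometry_vimage_open[OF fs iso that])
  have "emeasure M (inv_map \<sigma> -` U \<inter> J) = emeasure M U" if U: "openin R.mtopology U" for U
  proof -
    have "\<sigma> -` (inv_map \<sigma> -` U \<inter> J) \<inter> J = U"
      using open_subset_J[OF U] Aut_inv_left[OF \<sigma>] Aut_closed[OF \<sigma>] by force
    moreover have "emeasure M (\<sigma> -` (inv_map \<sigma> -` U \<inter> J) \<inter> J) = emeasure M (inv_map \<sigma> -` U \<inter> J)"
      using emeasure_distr[OF Aut_measurable[OF \<sigma>] open_measurable[OF op[OF U]]] Aut_distr[OF \<sigma>] by simp
    ultimately show ?thesis by simp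
  qed
  from measure_preserving_if_open[OF fs op this]
  have mp: "inv_map \<sigma> \<in> measurable M M" "distr M M (inv_map \<sigma>) = M" by blast+
  have "AE y in M. W (inv_map \<sigma> x) (inv_map \<sigma> y) = W x y" if x: "x \<in> J" for x
    using measure_preserving_AE[OF mp Aut_AE_W[OF \<sigma> funcset_mem[OF fs x]]] AE_space
    by eventually_elim (simp only: Aut_inv_right[OF \<sigma>] x)
  then show ?thesis using B mp by (simp add: graphon_auto_def)
qed

lemma Aut_compose:
  assumes \<sigma>: "\<sigma> \<in> Aut" and \<tau>: "\<tau> \<in> Aut"
  shows "compose J \<sigma> \<tau> \<in> Aut"
proof -
  have cm: "compose J \<sigma> \<tau> \<in> measurable M M \<longleftrightarrow> (\<lambda>x. \<sigma> (\<tau> x)) \<in> measurable M M"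
    by (rule measurable_cong) (simp add: compose_eq)
  have m: "(\<lambda>x. \<sigma> (\<tau> x)) \<in> measurable M M"
    by (rule measurable_compose[OF Aut_measurable[OF \<tau>] Aut_measurable[OF \<sigma>]])
  have "distr M M (compose J \<sigma> \<tau>) = distr M M (\<sigma> \<circ> \<tau>)"
    by (rule distr_cong) (auto simp: compose_eq)
  also have "\<dots> = distr (distr M M \<tau>) M \<sigma>"
    by (rule distr_distr[OF Aut_measurable[OF \<sigma>] Aut_measurable[OF \<tau>], symmetric])
  also have "\<dots> = M" using Aut_distr[OF \<sigma>] Aut_distr[OF \<tau>] by simp
  finally have d: "distr M M (compose J \<sigma> \<tau>) = M" .
  have "AE y in M. W (compose J \<sigma> \<tau> x) (compose J \<sigma> \<tau> y) = W x y" if x: "x \<in> J" for x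
    using measure_preserving_AE[OF Aut_measurable[OF \<tau>] Aut_distr[OF \<tau>] Aut_AE_W[OF \<sigma> Aut_closed[OF \<tau> x]]]
      Aut_AE_W[OF \<tau> x] AE_space
    by eventually_elim (simp add: compose_eq x)
  then show ?thesis
    using d m compose_Bij[OF Aut_Bij[OF \<sigma>] Aut_Bij[OF \<tau>]] by (simp add: graphon_auto_def cm)
qed

lemma Aut_id: "(\<lambda>x\<in>J. x) \<in> Aut"
proof -
  have "distr M M (\<lambda>x\<in>J. x) = distr M M (\<lambda>x. x)" by (rule distr_cong) auto
  moreover have "(\<lambda>x\<in>J. x) \<in> measurable M M \<longleftrightarrow> (\<lambda>x. x) \<in> measurable M M"
    by (rule measurable_cong) simp
  ultimately show ?thesis by (auto simp: graphon_auto_def id_Bij distr_id2)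
qed

lemma group_graphon_Aut: "group (graphon_Aut M W)"
proof -
  interpret G: group "BijGroup J" by (rule group_BijGroup)
  have "subgroup Aut (BijGroup J)"
  proof (rule G.subgroupI)
    show "Aut \<subseteq> carrier (BijGroup J)" using Aut_Bij by (auto simp: BijGroup_def)
    show "Aut \<noteq> {}" using Aut_id by auto
    show "inv\<^bsub>BijGroup J\<^esub> \<sigma> \<in> Aut" if "\<sigma> \<in> Aut" for \<sigma>
      using inv_BijGroup[OF Aut_Bij[OF that]] Aut_inv[OF that] by simp
    show "\<sigma> \<otimes>\<^bsub>BijGroup J\<^esub> \<tau> \<in> Aut" if "\<sigma> \<in> Aut" "\<tau> \<in> Aut" for \<sigma> \<tau>
      using Aut_compose[OF that] Aut_Bij[OF that(1)] Aut_Bij[OF that(2)] by (simp add: BijGroup_def)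
  qed
  then show ?thesis unfolding graphon_Aut_def by (rule G.subgroup_imp_group)
qed

section \<open>The uniform distance and its relation to the completion\<close>

definition unif_dist :: "('a \<Rightarrow> 'a) \<Rightarrow> ('a \<Rightarrow> 'a) \<Rightarrow> real" where
  "unif_dist \<sigma> \<tau> = (SUP x\<in>J. r2 (\<sigma> x) (\<tau> x))"

lemma le_unif_dist:
  assumes "\<sigma> \<in> Aut" "\<tau> \<in> Aut" "x \<in> J"
  shows "r2 (\<sigma> x) (\<tau> x) \<le> unif_dist \<sigma> \<tau>"
  unfolding unif_dist_def
  by (rule cSUP_upper[OF assms(3) bdd_aboveI2[of _ _ 1]])
    (intro nbhd2_dist_le_1 Aut_closed[OF assms(1)] Aut_closed[OF assms(2)])

lemma unif_dist_le: "(\<And>x. x \<in> J \<Longrightarrow> r2 (\<sigma> x) (\<tau> x) \<le> e) \<Longrightarrow> unif_dist \<sigma> \<tau> \<le> e"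
  unfolding unif_dist_def by (rule cSUP_least[OF not_empty])

lemma Aut_MCauchy:
  assumes "\<sigma> \<in> Aut" "R2.MCauchy s"
  shows "R2.MCauchy (\<sigma> \<circ> s)"
proof -
  have sJ: "s n \<in> J" for n using assms(2) by (auto simp: R2.MCauchy_def)
  then show ?thesis
    using assms(2) Aut_closed[OF assms(1) sJ] Aut_r2[OF assms(1) sJ sJ]
    by (auto simp: R2.MCauchy_def)
qed

text \<open>Any representative of the image class is asymptotic to the image of the chosen
  representative \<open>s\<close>. This makes the distance of two image classes computable from
  \<open>s\<close> alone.\<close>

lemma completion_map_nearby:
  assumes \<sigma>: "\<sigma> \<in> Aut" and s: "R2.MCauchy s"
    and u: "u \<in> completion_map J r2 \<sigma> (cauchy_equiv J r2 `` {s})"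
  shows "range u \<subseteq> J" "(\<lambda>n. r2 (u n) (\<sigma> (s n))) \<longlonglongrightarrow> 0"
proof -
  from u obtain t where t: "R2.MCauchy t" "(\<lambda>n. r2 (s n) (t n)) \<longlonglongrightarrow> 0"
    and u: "R2.MCauchy u" "(\<lambda>n. r2 (\<sigma> (t n)) (u n)) \<longlonglongrightarrow> 0"
    by (auto simp: completion_map_def cauchy_equiv_def)
  have J: "s n \<in> J" "t n \<in> J" "u n \<in> J" for n
    using s t u by (auto simp: R2.MCauchy_def)
  show "range u \<subseteq> J" using J by auto
  have le: "r2 (u n) (\<sigma> (s n)) \<le> r2 (\<sigma> (t n)) (u n) + r2 (s n) (t n)" for n
    using R2.triangle[OF J(3) Aut_closed[OF \<sigma> J(2)] Aut_closed[OF \<sigma> J(1)], of n n n]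
      Aut_r2[OF \<sigma> J(2) J(1), of n n] R2.commute[of "u n" "\<sigma> (t n)"] R2.commute[of "t n" "s n"] by linarith
  have "(\<lambda>n. r2 (\<sigma> (t n)) (u n) + r2 (s n) (t n)) \<longlonglongrightarrow> 0"
    using tendsto_add[OF u(2) t(2)] by simp
  then show "(\<lambda>n. r2 (u n) (\<sigma> (s n))) \<longlonglongrightarrow> 0"
    by (rule Lim_null_comparison[rotated]) (simp add: le)
qed

text \<open>The \<open>THE\<close> in \<open>completion_dist\<close> asks for one limit shared by
  all representatives. Along \<open>s\<close> a limit \<open>l\<close> exists because the real
  sequence of distances is Cauchy; asymptotic representatives share it; and it is unique because
  both image classes are nonempty.\<close>

lemma completion_dist_lim:
  assumes \<sigma>: "\<sigma> \<in> Aut" and \<tau>: "\<tau> \<in> Aut" and s: "R2.MCauchy s"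
  defines "X \<equiv> cauchy_equiv J r2 `` {s}"
  shows "(\<lambda>n. r2 (\<sigma> (s n)) (\<tau> (s n))) \<longlonglongrightarrow>
    completion_dist r2 (completion_map J r2 \<sigma> X) (completion_map J r2 \<tau> X)"
proof -
  have sJ: "s n \<in> J" for n using s by (auto simp: R2.MCauchy_def)
  have \<sigma>J: "\<sigma> (s n) \<in> J" and \<tau>J: "\<tau> (s n) \<in> J" for n by (rule Aut_closed[OF \<sigma> sJ], rule Aut_closed[OF \<tau> sJ])
  have quad: "\<bar>r2 a b - r2 a' b'\<bar> \<le> r2 a a' + r2 b b'"
    if "a \<in> J" "b \<in> J" "a' \<in> J" "b' \<in> J" for a b a' b'
    using R2.triangle[of a a' b] R2.triangle[of a' b' b] R2.triangle[of a' a b'] R2.triangle[of a b b'] that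
    by (simp add: R2.commute)
  have "Cauchy (\<lambda>n. r2 (\<sigma> (s n)) (\<tau> (s n)))"
  proof (rule metric_CauchyI)
    fix e :: real assume "0 < e"
    then have "0 < e / 2" by simp
    then obtain N where N: "\<And>m n. m \<ge> N \<Longrightarrow> n \<ge> N \<Longrightarrow> r2 (s m) (s n) < e / 2"
      using s unfolding R2.MCauchy_def by blast
    have "dist (r2 (\<sigma> (s m)) (\<tau> (s m))) (r2 (\<sigma> (s n)) (\<tau> (s n))) < e" if "m \<ge> N" "n \<ge> N" for m n
      using quad[OF \<sigma>J \<tau>J \<sigma>J \<tau>J, of m m n n] N[OF that] Aut_r2[OF \<sigma> sJ sJ, of m n] Aut_r2[OF \<tau> sJ sJ, of m n]
      by (simp add: dist_real_def)
    then show "\<exists>N. \<forall>m\<ge>N. \<forall>n\<ge>N. dist (r2 (\<sigma> (s m)) (\<tau> (s m))) (r2 (\<sigma> (s n)) (\<tau> (s n))) < e" by blast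
  qed
  then obtain l where l: "(\<lambda>n. r2 (\<sigma> (s n)) (\<tau> (s n))) \<longlonglongrightarrow> l"
    using Cauchy_convergent convergent_def by blast
  have all: "(\<lambda>n. r2 (u n) (v n)) \<longlonglongrightarrow> l"
    if uv: "u \<in> completion_map J r2 \<sigma> X" "v \<in> completion_map J r2 \<tau> X" for u v
  proof -
    note u = completion_map_nearby[OF \<sigma> s uv(1)[unfolded X_def]]
    note v = completion_map_nearby[OF \<tau> s uv(2)[unfolded X_def]]
    have uJ: "u n \<in> J" and vJ: "v n \<in> J" for n using u v by auto
    have "(\<lambda>n. r2 (u n) (v n) - r2 (\<sigma> (s n)) (\<tau> (s n))) \<longlonglongrightarrow> 0"
    proof (rule Lim_null_comparison)
      show "(\<lambda>n. r2 (u n) (\<sigma> (s n)) + r2 (v n) (\<tau> (s n))) \<longlonglongrightarrow> 0"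
        using tendsto_add[OF u(2) v(2)] by simp
    qed (use quad[OF uJ vJ \<sigma>J \<tau>J] in auto)
    from tendsto_add[OF this l] show ?thesis by simp
  qed
  have "s \<in> X" using s by (simp add: X_def cauchy_equiv_def R2.MCauchy_def subset_iff)
  have "\<rho> \<circ> s \<in> completion_map J r2 \<rho> X" if "\<rho> \<in> Aut" for \<rho>
  proof -
    have "(\<rho> \<circ> s, \<rho> \<circ> s) \<in> cauchy_equiv J r2"
      using Aut_MCauchy[OF that s] by (simp add: cauchy_equiv_def R2.MCauchy_def subset_iff)
    with \<open>s \<in> X\<close> show ?thesis by (auto simp: completion_map_def)
  qed
  then have ne: "\<sigma> \<circ> s \<in> completion_map J r2 \<sigma> X" "\<tau> \<circ> s \<in> completion_map J r2 \<tau> X"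
    using \<sigma> \<tau> by auto
  have "completion_dist r2 (completion_map J r2 \<sigma> X) (completion_map J r2 \<tau> X) = l"
    unfolding completion_dist_def
  proof (rule the_equality)
    fix l' assume "\<forall>u\<in>completion_map J r2 \<sigma> X. \<forall>v\<in>completion_map J r2 \<tau> X. (\<lambda>n. r2 (u n) (v n)) \<longlonglongrightarrow> l'"
    then show "l' = l" using LIMSEQ_unique all ne by blast
  qed (use all in blast)
  with l show ?thesis by simp
qed

text \<open>At a point of the completion the distance is a limit of values taken on
  \<open>J\<close>, so it does not exceed their supremum. Conversely, constant sequences recover the
  value at each point of \<open>J\<close>.\<close>

lemma aut_dist_eq:
  assumes \<sigma>: "\<sigma> \<in> Aut" and \<tau>: "\<tau> \<in> Aut"
  shows "aut_dist M W \<sigma> \<tau> = unif_dist \<sigma> \<tau>"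
proof -
  let ?E = "cauchy_equiv J r2"
  let ?d = "\<lambda>X. completion_dist r2 (completion_map J r2 \<sigma> X) (completion_map J r2 \<tau> X)"
  have le: "?d X \<le> unif_dist \<sigma> \<tau>" if "X \<in> completion_points J r2" for X
  proof -
    from that obtain s where s: "R2.MCauchy s" "X = ?E `` {s}"
      by (auto simp: completion_points_def quotient_def)
    have "s n \<in> J" for n using s by (auto simp: R2.MCauchy_def)
    with completion_dist_lim[OF \<sigma> \<tau> s(1)] le_unif_dist[OF \<sigma> \<tau>] show ?thesis
      unfolding s(2) by (intro LIMSEQ_le_const2) auto
  qed
  have const: "\<exists>X\<in>completion_points J r2. ?d X = r2 (\<sigma> x) (\<tau> x)" if "x \<in> J" for x
  proof (rule bexI)
    have s: "R2.MCauchy (\<lambda>_. x)" using that by simp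
    then show "?E `` {\<lambda>_. x} \<in> completion_points J r2"
      by (auto simp: completion_points_def intro: quotientI)
    show "?d (?E `` {\<lambda>_. x}) = r2 (\<sigma> x) (\<tau> x)"
      using completion_dist_lim[OF \<sigma> \<tau> s] LIMSEQ_unique tendsto_const by blast
  qed
  have "(SUP X\<in>completion_points J r2. ?d X) = unif_dist \<sigma> \<tau>"
  proof (rule antisym)
    have "completion_points J r2 \<noteq> {}" using const not_empty by blast
    then show "(SUP X\<in>completion_points J r2. ?d X) \<le> unif_dist \<sigma> \<tau>"
      by (rule cSUP_least) (rule le)
    show "unif_dist \<sigma> \<tau> \<le> (SUP X\<in>completion_points J r2. ?d X)"
    proof (rule unif_dist_le)
      fix x assume "x \<in> J"
      then obtain X where X: "X \<in> completion_points J r2" "?d X = r2 (\<sigma> x) (\<tau> x)"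
        using const by blast
      have "bdd_above (?d ` completion_points J r2)" using le by (rule bdd_aboveI2)
      from cSUP_upper[OF X(1) this] X(2) show "r2 (\<sigma> x) (\<tau> x) \<le> (SUP X\<in>completion_points J r2. ?d X)"
        by simp
    qed
  qed
  then show ?thesis using \<sigma> \<tau> by (simp add: aut_dist_def)
qed

lemma carrier_graphon_Aut: "carrier (graphon_Aut M W) = Aut"
  by (simp add: graphon_Aut_def)

lemma unif_dist_commute: "unif_dist \<sigma> \<tau> = unif_dist \<tau> \<sigma>"
  by (simp add: unif_dist_def R2.commute)

lemma unif_dist_nonneg: "\<sigma> \<in> Aut \<Longrightarrow> \<tau> \<in> Aut \<Longrightarrow> 0 \<le> unif_dist \<sigma> \<tau>"
  using le_unif_dist not_empty R2.nonneg order_trans by blast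

sublocale A: Metric_space "graphon_auto M W" "aut_dist M W"
proof
  show "0 \<le> aut_dist M W \<sigma> \<tau>" for \<sigma> \<tau>
  proof (cases "\<sigma> \<in> Aut \<and> \<tau> \<in> Aut")
    case True
    then show ?thesis by (simp add: aut_dist_eq unif_dist_nonneg)
  qed (auto simp: aut_dist_def)
  show "aut_dist M W \<sigma> \<tau> = aut_dist M W \<tau> \<sigma>" for \<sigma> \<tau>
  proof (cases "\<sigma> \<in> Aut \<and> \<tau> \<in> Aut")
    case True
    then show ?thesis by (simp add: aut_dist_eq unif_dist_commute)
  qed (auto simp: aut_dist_def)
  show "aut_dist M W \<sigma> \<tau> = 0 \<longleftrightarrow> \<sigma> = \<tau>" if st: "\<sigma> \<in> Aut" "\<tau> \<in> Aut" for \<sigma> \<tau>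
  proof
    assume "aut_dist M W \<sigma> \<tau> = 0"
    then have 0: "r2 (\<sigma> x) (\<tau> x) = 0" if "x \<in> J" for x
      using le_unif_dist[OF st that] R2.nonneg[of "\<sigma> x" "\<tau> x"] by (simp add: aut_dist_eq[OF st])
    show "\<sigma> = \<tau>"
    proof (rule Aut_eqI[OF st])
      fix x assume x: "x \<in> J"
      show "\<sigma> x = \<tau> x"
        using R2.zero[OF Aut_closed[OF st(1) x] Aut_closed[OF st(2) x]] 0[OF x] by simp
    qed
  next
    assume "\<sigma> = \<tau>"
    then show "aut_dist M W \<sigma> \<tau> = 0"
      using unif_dist_le[of \<sigma> \<tau> 0] unif_dist_nonneg[OF st] R2.mdist_zero[OF Aut_closed[OF st(1)]]
      unfolding aut_dist_eq[OF st] by force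
  qed
  show "aut_dist M W \<sigma> \<rho> \<le> aut_dist M W \<sigma> \<tau> + aut_dist M W \<tau> \<rho>"
    if st: "\<sigma> \<in> Aut" "\<tau> \<in> Aut" "\<rho> \<in> Aut" for \<sigma> \<tau> \<rho>
    unfolding aut_dist_eq[OF st(1,3)] aut_dist_eq[OF st(1,2)] aut_dist_eq[OF st(2,3)]
  proof (rule unif_dist_le)
    fix x assume x: "x \<in> J"
    show "r2 (\<sigma> x) (\<rho> x) \<le> unif_dist \<sigma> \<tau> + unif_dist \<tau> \<rho>"
      using R2.triangle[OF Aut_closed[OF st(1) x] Aut_closed[OF st(2) x] Aut_closed[OF st(3) x]]
        le_unif_dist[OF st(1,2) x] le_unif_dist[OF st(2,3) x] by linarith
  qed
qed

section \<open>Total boundedness of the automorphism group\<close>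

lemma Aut_mtotally_bounded: "A.mtotally_bounded Aut"
  unfolding A.mtotally_bounded_def
proof (intro allI impI)
  fix e :: real assume e: "0 < e"
  define \<delta> where "\<delta> = e / 5"
  have \<delta>: "0 < \<delta>" using e by (simp add: \<delta>_def)
  obtain F where F: "finite F" "F \<subseteq> J" "\<And>x. x \<in> J \<Longrightarrow> \<exists>y\<in>F. r2 y x < \<delta>"
    by (rule nbhd2_dist_finite_net[OF \<delta>]) (rule that)
  define near where "near x = (SOME y. y \<in> F \<and> r2 y x < \<delta>)" for x
  have near: "near x \<in> F" "r2 (near x) x < \<delta>" if "x \<in> J" for x
    using someI_ex[OF F(3)[OF that, unfolded Bex_def]] unfolding near_def by (rule conjunct1, rule conjunct2)
  \<comment> \<open>This is the argument of Arzela and Ascoli. The color of \<open>\<sigma>\<close>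
    records its values on the net \<open>F\<close>, rounded to \<open>F\<close>; since automorphisms
    are isometries for \<open>r2\<close>, equal colors give distance at most
    \<open>4 * \<delta>\<close> at every point: two errors from moving to the net and two from
    rounding.\<close>
  define c where "c \<sigma> = (\<lambda>w\<in>F. near (\<sigma> w))" for \<sigma> :: "'a \<Rightarrow> 'a"
  have "c \<sigma> \<in> F \<rightarrow>\<^sub>E F" if \<sigma>: "\<sigma> \<in> Aut" for \<sigma>
    unfolding c_def by (intro restrict_PiE_iff[THEN iffD2] ballI near(1) Aut_closed[OF \<sigma>] subsetD[OF F(2)])
  then have "c ` Aut \<subseteq> F \<rightarrow>\<^sub>E F" by (rule image_subsetI)
  then have fin: "finite (c ` Aut)" by (rule finite_subset) (intro finite_PiE F)
  have close: "aut_dist M W \<sigma> \<tau> < e" if st: "\<sigma> \<in> Aut" "\<tau> \<in> Aut" and eq: "c \<sigma> = c \<tau>" for \<sigma> \<tau>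
  proof -
    have "r2 (\<sigma> x) (\<tau> x) \<le> 4 * \<delta>" if x: "x \<in> J" for x
    proof -
      obtain w where w: "w \<in> F" "r2 w x < \<delta>" using F(3)[OF x] by auto
      have wJ: "w \<in> J" using w F by auto
      let ?y = "near (\<sigma> w)"
      have y: "?y = near (\<tau> w)" using fun_cong[OF eq, of w] w by (simp add: c_def)
      have J: "\<sigma> x \<in> J" "\<tau> x \<in> J" "\<sigma> w \<in> J" "\<tau> w \<in> J" by (intro Aut_closed[OF st(1)] Aut_closed[OF st(2)] x wJ)+
      have yJ: "?y \<in> J" by (rule subsetD[OF F(2) near(1)[OF J(3)]])
      have "r2 (\<sigma> x) (\<tau> x) \<le> r2 (\<sigma> x) (\<sigma> w) + (r2 (\<sigma> w) ?y + (r2 ?y (\<tau> w) + r2 (\<tau> w) (\<tau> x)))"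
        using R2.triangle[OF J(1) J(3) J(2)] R2.triangle[OF J(3) yJ J(2)] R2.triangle[OF yJ J(4) J(2)]
        by linarith
      moreover have "r2 (\<sigma> x) (\<sigma> w) < \<delta>" "r2 (\<tau> w) (\<tau> x) < \<delta>"
        using Aut_r2[OF st(1) x wJ] Aut_r2[OF st(2) wJ x] w(2) by (simp_all add: R2.commute)
      moreover have "r2 (\<sigma> w) ?y < \<delta>" "r2 ?y (\<tau> w) < \<delta>"
        using near(2)[OF J(3)] near(2)[OF J(4)] y by (simp_all add: R2.commute)
      ultimately show ?thesis by linarith
    qed
    then have "unif_dist \<sigma> \<tau> \<le> 4 * \<delta>" by (rule unif_dist_le)
    then show ?thesis using e by (simp add: aut_dist_eq[OF st] \<delta>_def)
  qed
  obtain K where K: "finite K" "K \<subseteq> Aut" "\<And>\<sigma>. \<sigma> \<in> Aut \<Longrightarrow> \<exists>\<tau>\<in>K. aut_dist M W \<tau> \<sigma> < e"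
    by (rule finite_image_imp_finite_net[of c Aut "aut_dist M W" e, OF fin], erule (2) close, rule that)
  have "Aut \<subseteq> (\<Union>\<sigma>\<in>K. A.mball \<sigma> e)"
  proof
    fix \<sigma> assume \<sigma>: "\<sigma> \<in> Aut"
    with K obtain \<tau> where "\<tau> \<in> K" "aut_dist M W \<tau> \<sigma> < e" by blast
    with \<sigma> K show "\<sigma> \<in> (\<Union>\<sigma>\<in>K. A.mball \<sigma> e)" by auto
  qed
  with K show "\<exists>K. finite K \<and> K \<subseteq> Aut \<and> Aut \<subseteq> (\<Union>\<sigma>\<in>K. A.mball \<sigma> e)" by blast
qed

section \<open>Completeness\<close>

lemma nbhd2_dist_le_nbhd_dist: "x \<in> J \<Longrightarrow> y \<in> J \<Longrightarrow> r2 x y \<le> r x y"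
  by (simp only: nbhd2_dist_eq)
    (intro integral_le_const integrable_codegree_diff AE_I2 codegree_lipschitz)

text \<open>A codegree difference at \<open>z\<close> persists on the ball around \<open>z\<close>,
  up to a loss of \<open>a\<close> for each of the two 1-Lipschitz functions. Integrating over the
  ball turns control of \<open>r2\<close> into control of codegrees at a point.\<close>

lemma nbhd2_dist_ge_ball:
  assumes x: "x \<in> J" and y: "y \<in> J" and z: "z \<in> J"
  shows "(\<bar>k x z - k y z\<bar> - 2 * a) * prob (R.mball z a) \<le> r2 x y"
proof -
  let ?c = "\<bar>k x z - k y z\<bar> - 2 * a" and ?B = "R.mball z a"
  have B: "?B \<in> sets M" by (rule open_measurable) simp
  have "?c * indicator ?B u \<le> \<bar>k x u - k y u\<bar>" if u: "u \<in> J" for u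
    using codegree_lipschitz2[OF x z u] codegree_lipschitz2[OF y z u]
    by (auto simp: indicator_def)
  then have "(\<integral>u. ?c * indicator ?B u \<partial>M) \<le> (\<integral>u. \<bar>k x u - k y u\<bar> \<partial>M)"
    using B by (intro integral_mono integrable_codegree_diff[OF x y]) (auto simp: emeasure_eq_measure)
  moreover have "(\<integral>u. ?c * indicator ?B u \<partial>M) = ?c * prob ?B"
    using B by (simp add: Int_absorb2[OF R.mball_subset_mspace])
  ultimately show ?thesis by (simp only: nbhd2_dist_eq[OF x y])
qed

text \<open>An automorphism preserves the norm of \<open>W x\<close>, so the squared distance of \<open>W (\<tau> x)\<close> and
  \<open>W x\<close> is twice the drop of their inner product, and this drop is controlled by the
  2-neighborhood distance. Hence the two distances are equivalent along orbits.\<close>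

lemma orbit_close:
  assumes x: "x \<in> J" and e: "0 < e"
  obtains \<delta> where "0 < \<delta>" "\<And>\<tau>. \<tau> \<in> Aut \<Longrightarrow> r2 (\<tau> x) x < \<delta> \<Longrightarrow> r (\<tau> x) x < e"
proof
  \<comment> \<open>With \<open>?\<delta>\<close> below, the codegree drop is less than
    \<open>4 * a\<close>. The bound of \<open>r_sq_le\<close> is twice that drop, hence less than
    \<open>8 * a\<close>, which is the square of \<open>e\<close>.\<close>
  define a where "a = e\<^sup>2 / 8"
  have a: "0 < a" using e by (simp add: a_def)
  have p: "0 < prob (R.mball x a)"
    using open_pos[of "R.mball x a"] x a by (force simp: emeasure_eq_measure)
  let ?\<delta> = "2 * a * prob (R.mball x a)"
  show "0 < ?\<delta>" using a p by simp
  fix \<tau> assume \<tau>: "\<tau> \<in> Aut" and small: "r2 (\<tau> x) x < ?\<delta>"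
  have \<tau>x: "\<tau> x \<in> J" by (rule Aut_closed[OF \<tau> x])
  have "(\<bar>k (\<tau> x) x - k x x\<bar> - 2 * a) * prob (R.mball x a) < 2 * a * prob (R.mball x a)"
    using nbhd2_dist_ge_ball[OF \<tau>x x x] small by (rule le_less_trans)
  then have "\<bar>k (\<tau> x) x - k x x\<bar> < 4 * a" using p by simp
  moreover have "4 * a = e\<^sup>2 / 2" by (simp add: a_def)
  ultimately have "(r (\<tau> x) x)\<^sup>2 < e\<^sup>2"
    using r_sq_le[OF \<tau>x x] Aut_codegree[OF \<tau> x x] by linarith
  then show "r (\<tau> x) x < e" using e by (simp add: power_less_imp_less_base)
qed

section \<open>Pointwise limits of automorphisms\<close>

lemma pointwise_limit:
  assumes s: "\<And>n. s n \<in> Aut"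
    and cauchy: "\<And>e. 0 < e \<Longrightarrow> \<exists>N. \<forall>m\<ge>N. \<forall>n\<ge>N. \<forall>x\<in>J. r2 (s m x) (s n x) < e"
  obtains L where "L \<in> extensional J" "L \<in> J \<rightarrow> J" "\<And>x. x \<in> J \<Longrightarrow> (\<lambda>n. r (s n x) (L x)) \<longlonglongrightarrow> 0"
proof -
  have "\<exists>l\<in>J. (\<lambda>n. r (s n x) l) \<longlonglongrightarrow> 0" if x: "x \<in> J" for x
  proof -
    have sJ: "s n x \<in> J" for n by (rule Aut_closed[OF s x])
    have "R.MCauchy (\<lambda>n. s n x)"
      unfolding R.MCauchy_def
    proof (intro conjI allI impI)
      fix e :: real assume "0 < e"
      then obtain \<delta> where \<delta>: "0 < \<delta>" "\<And>\<tau>. \<tau> \<in> Aut \<Longrightarrow> r2 (\<tau> x) x < \<delta> \<Longrightarrow> r (\<tau> x) x < e"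
        by (rule orbit_close[OF x]) (rule that)
      obtain N where N: "\<forall>m\<ge>N. \<forall>n\<ge>N. \<forall>x\<in>J. r2 (s m x) (s n x) < \<delta>"
        using cauchy[OF \<delta>(1)] by blast
      have "r (s m x) (s n x) < e" if mn: "N \<le> m" "N \<le> n" for m n
      proof -
        \<comment> \<open>\<open>orbit_close\<close> compares a point only with its own images, so
          \<open>s m x\<close> and \<open>s n x\<close> are both moved back by the inverse of
          \<open>s n\<close>, an isometry for both distances. Its \<open>\<delta>\<close> may depend
          on \<open>x\<close>, and so convergence in \<open>r\<close> is obtained only
          pointwise.\<close>
        let ?\<tau> = "compose J (inv_map (s n)) (s m)"
        have \<tau>: "?\<tau> \<in> Aut" by (rule Aut_compose[OF Aut_inv[OF s] s])
        have \<tau>x: "?\<tau> x \<in> J" by (rule Aut_closed[OF \<tau> x])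
        have eq: "s n (?\<tau> x) = s m x"
          unfolding compose_eq[OF x] by (rule Aut_inv_right[OF s sJ])
        have "r2 (?\<tau> x) x = r2 (s m x) (s n x)"
          using Aut_r2[OF s \<tau>x x, of n] unfolding eq by simp
        also have "\<dots> < \<delta>" using N mn x by blast
        finally have "r (?\<tau> x) x < e" by (rule \<delta>(2)[OF \<tau>])
        then show ?thesis using Aut_r[OF s \<tau>x x, of n] unfolding eq by simp
      qed
      then show "\<exists>N. \<forall>m n. N \<le> m \<longrightarrow> N \<le> n \<longrightarrow> r (s m x) (s n x) < e" by blast
    qed (use sJ in auto)
    then obtain l where "limitin R.mtopology (\<lambda>n. s n x) l sequentially"
      using r_complete unfolding R.mcomplete_def by blast
    then show ?thesis unfolding R.limitin_metric_dist_null by blast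
  qed
  then obtain L where L: "\<And>x. x \<in> J \<Longrightarrow> L x \<in> J" "\<And>x. x \<in> J \<Longrightarrow> (\<lambda>n. r (s n x) (L x)) \<longlonglongrightarrow> 0"
    by metis
  show thesis
  proof (rule that)
    show "restrict L J \<in> extensional J" by simp
    show "restrict L J \<in> J \<rightarrow> J" by (rule restrictI) (rule L(1))
    show "(\<lambda>n. r (s n x) (restrict L J x)) \<longlonglongrightarrow> 0" if "x \<in> J" for x
      unfolding restrict_apply'[OF that] by (rule L(2)[OF that])
  qed
qed

lemma limit_isometry:
  assumes s: "\<And>n. s n \<in> Aut" and L: "L \<in> J \<rightarrow> J"
    and lim: "\<And>x. x \<in> J \<Longrightarrow> (\<lambda>n. r (s n x) (L x)) \<longlonglongrightarrow> 0"
    and x: "x \<in> J" and y: "y \<in> J"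
  shows "r (L x) (L y) = r x y"
proof -
  have J: "s n x \<in> J" "s n y \<in> J" "L x \<in> J" "L y \<in> J" for n
    using funcset_mem[OF L] Aut_closed[OF s] x y by blast+
  have "(\<lambda>n. r (s n x) (L x) + r (s n y) (L y)) \<longlonglongrightarrow> 0"
    using tendsto_add[OF lim[OF x] lim[OF y]] by simp
  moreover have "\<bar>r (L x) (L y) - r x y\<bar> \<le> r (s n x) (L x) + r (s n y) (L y)" for n
    using R.triangle[OF J(3) J(1)[of n] J(4)] R.triangle[OF J(1)[of n] J(2)[of n] J(4)]
      R.triangle[OF J(1)[of n] J(3) J(2)[of n]] R.triangle[OF J(3) J(4) J(2)[of n]]
      Aut_r[OF s x y, of n] R.commute[of "L x" "s n x"] R.commute[of "L y" "s n y"]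
    by linarith
  ultimately have "\<bar>r (L x) (L y) - r x y\<bar> \<le> 0"
    by (intro LIMSEQ_le_const) auto
  then show ?thesis by simp
qed

text \<open>Since \<open>s n\<close> is an isometry, \<open>x = s n (t n x)\<close> is as far from
  \<open>s n (L' x)\<close> as \<open>t n x\<close> is from \<open>L' x\<close>, which tends to
  \<open>0\<close>. The one-sided form allows a second use with the roles of the two sequences
  exchanged.\<close>

lemma limit_inverse:
  assumes s: "\<And>n. s n \<in> Aut" and t: "\<And>n x. x \<in> J \<Longrightarrow> t n x \<in> J" "\<And>n x. x \<in> J \<Longrightarrow> s n (t n x) = x"
    and L: "L \<in> J \<rightarrow> J" "\<And>x. x \<in> J \<Longrightarrow> (\<lambda>n. r (s n x) (L x)) \<longlonglongrightarrow> 0"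
    and L': "L' \<in> J \<rightarrow> J" "\<And>x. x \<in> J \<Longrightarrow> (\<lambda>n. r (t n x) (L' x)) \<longlonglongrightarrow> 0"
    and x: "x \<in> J"
  shows "L (L' x) = x"
proof -
  have L'x: "L' x \<in> J" by (rule funcset_mem[OF L'(1) x])
  have LL'x: "L (L' x) \<in> J" by (rule funcset_mem[OF L(1) L'x])
  have "(\<lambda>n. r (t n x) (L' x) + r (s n (L' x)) (L (L' x))) \<longlonglongrightarrow> 0"
    using tendsto_add[OF L'(2)[OF x] L(2)[OF L'x]] by simp
  moreover have "r x (L (L' x)) \<le> r (t n x) (L' x) + r (s n (L' x)) (L (L' x))" for n
    using R.triangle[OF x Aut_closed[OF s L'x, of n] LL'x] Aut_r[OF s t(1)[OF x] L'x, of n n]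
    unfolding t(2)[OF x] by linarith
  ultimately have "r x (L (L' x)) \<le> 0"
    by (intro LIMSEQ_le_const) auto
  then show ?thesis using R.zero[OF x LL'x] R.nonneg[of x "L (L' x)"] by simp
qed

section \<open>Preservation of the measure and of \<open>W\<close> in the limit\<close>

lemma nn_integral_vimage_limit_le:
  assumes s: "\<And>n. s n \<in> Aut" and L: "L \<in> J \<rightarrow> J"
    and lim: "\<And>x. x \<in> J \<Longrightarrow> (\<lambda>n. r (s n x) (L x)) \<longlonglongrightarrow> 0"
    and U: "openin R.mtopology U" and f: "f \<in> borel_measurable M"
    and le: "\<And>e. 0 < e \<Longrightarrow>
      eventually (\<lambda>n. (\<integral>\<^sup>+x\<in>(s n -` U \<inter> J). f x \<partial>M) \<le> C + ennreal e) sequentially"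
  shows "(\<integral>\<^sup>+x\<in>(L -` U \<inter> J). f x \<partial>M) \<le> C"
proof (rule ennreal_le_epsilon)
  fix e :: real assume e: "0 < e"
  \<comment> \<open>If \<open>L x\<close> lies in the open set \<open>U\<close>, then so does
    \<open>s n x\<close> for all large \<open>n\<close>. Hence the indicator of the limiting
    preimage is below the limes inferior of the others, and Fatou's lemma applies.\<close>
  have pt: "f x * indicator (L -` U \<inter> J) x \<le> liminf (\<lambda>n. f x * indicator (s n -` U \<inter> J) x)"
    if x: "x \<in> J" for x
  proof (cases "L x \<in> U")
    case True
    then obtain d where d: "0 < d" "R.mball (L x) d \<subseteq> U" using U by (auto simp: R.openin_mtopology)
    have "eventually (\<lambda>n. r (s n x) (L x) < d) sequentially"
      using lim[OF x] d(1) by (rule order_tendstoD)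
    then show ?thesis
    proof (intro Liminf_bounded, eventually_elim)
      case (elim n)
      have "s n x \<in> R.mball (L x) d"
        using elim Aut_closed[OF s x, of n] funcset_mem[OF L x] by (simp add: R.commute)
      then show ?case using d(2) x by (auto simp: indicator_def)
    qed
  qed simp
  have m: "(\<lambda>x. f x * indicator (s n -` U \<inter> J) x) \<in> borel_measurable M" for n
    using f measurable_sets[OF Aut_measurable[OF s] open_measurable[OF U]] by measurable
  have "(\<integral>\<^sup>+x\<in>(L -` U \<inter> J). f x \<partial>M) \<le> (\<integral>\<^sup>+x. liminf (\<lambda>n. f x * indicator (s n -` U \<inter> J) x) \<partial>M)"
    by (rule nn_integral_mono) (rule pt)
  also have "\<dots> \<le> liminf (\<lambda>n. \<integral>\<^sup>+x\<in>(s n -` U \<inter> J). f x \<partial>M)"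
    by (rule nn_integral_liminf[OF m])
  also have "\<dots> \<le> liminf (\<lambda>n. C + ennreal e)"
    by (rule Liminf_mono[OF le[OF e]])
  also have "\<dots> = C + ennreal e" by (rule Liminf_const) simp
  finally show "(\<integral>\<^sup>+x\<in>(L -` U \<inter> J). f x \<partial>M) \<le> C + ennreal e" .
qed

lemma emeasure_vimage_limit_le:
  assumes s: "\<And>n. s n \<in> Aut" and L: "L \<in> J \<rightarrow> J"
    and lim: "\<And>x. x \<in> J \<Longrightarrow> (\<lambda>n. r (s n x) (L x)) \<longlonglongrightarrow> 0"
    and U: "openin R.mtopology U"
  shows "emeasure M (L -` U \<inter> J) \<le> emeasure M U"
proof -
  have op: "openin R.mtopology (L -` U \<inter> J)"
    by (rule isometry_vimage_open[OF L limit_isometry[OF s L lim] U])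
  have eq: "(\<integral>\<^sup>+x\<in>(s n -` U \<inter> J). 1 \<partial>M) = emeasure M U" for n
    using emeasure_distr[OF Aut_measurable[OF s] open_measurable[OF U], of n]
      measurable_sets[OF Aut_measurable[OF s] open_measurable[OF U], of n]
    by (simp add: Aut_distr[OF s])
  have "(\<integral>\<^sup>+x\<in>(L -` U \<inter> J). 1 \<partial>M) \<le> emeasure M U"
    by (rule nn_integral_vimage_limit_le[OF s L lim U]) (assumption, simp, simp only: eq, simp)
  then show ?thesis using open_measurable[OF op] by simp
qed

lemma set_nn_integral_vimage:
  assumes \<sigma>: "\<sigma> \<in> measurable M M" "distr M M \<sigma> = M" and f: "f \<in> borel_measurable M"
    and U: "U \<in> sets M"
  shows "(\<integral>\<^sup>+x\<in>(\<sigma> -` U \<inter> J). f (\<sigma> x) \<partial>M) = (\<integral>\<^sup>+x\<in>U. f x \<partial>M)"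
proof -
  have m: "(\<lambda>x. f x * indicator U x) \<in> borel_measurable M" using f U by measurable
  have "(\<integral>\<^sup>+x\<in>U. f x \<partial>M) = (\<integral>\<^sup>+x. f x * indicator U x \<partial>distr M M \<sigma>)" by (simp only: \<sigma>(2))
  also have "\<dots> = (\<integral>\<^sup>+x. f (\<sigma> x) * indicator U (\<sigma> x) \<partial>M)"
    by (rule nn_integral_distr[OF \<sigma>(1)]) (use m in simp)
  also have "\<dots> = (\<integral>\<^sup>+x\<in>(\<sigma> -` U \<inter> J). f (\<sigma> x) \<partial>M)"
    by (rule nn_integral_cong) (simp add: indicator_def)
  finally show ?thesis by simp
qed

text \<open>Fatou's lemma only yields one inequality between the integrals of \<open>W x\<close> and of
  \<open>W (L x) \<circ> L\<close>; the function \<open>g\<close> is the identity or \<open>\<lambda>t. 1 - t\<close>, which gives both.\<close>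

lemma limit_W_integral_le:
  assumes s: "\<And>n. s n \<in> Aut" and L: "L \<in> J \<rightarrow> J"
    and lim: "\<And>x. x \<in> J \<Longrightarrow> (\<lambda>n. r (s n x) (L x)) \<longlonglongrightarrow> 0"
    and mp: "L \<in> measurable M M" "distr M M L = M"
    and U: "openin R.mtopology U" and x: "x \<in> J"
    and g: "\<And>a b. \<bar>g a - g b\<bar> \<le> \<bar>a - b\<bar>" "g \<in> borel_measurable borel"
  shows "(\<integral>\<^sup>+u\<in>(L -` U \<inter> J). ennreal (g (W x u)) \<partial>M) \<le> (\<integral>\<^sup>+u\<in>(L -` U \<inter> J). ennreal (g (W (L x) (L u))) \<partial>M)"
proof -
  have Um: "U \<in> sets M" by (rule open_measurable[OF U])
  have Lx: "L x \<in> J" by (rule funcset_mem[OF L x])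
  have gW: "(\<lambda>u. ennreal (g (W y u))) \<in> borel_measurable M" if "y \<in> J" for y
    using W_measurable[OF that] g(2) by measurable
  let ?C = "\<integral>\<^sup>+u\<in>U. ennreal (g (W (L x) u)) \<partial>M"
  have "(\<integral>\<^sup>+u\<in>(L -` U \<inter> J). ennreal (g (W x u)) \<partial>M) \<le> ?C"
  proof (rule nn_integral_vimage_limit_le[OF s L lim U gW[OF x]])
    fix e :: real assume e: "0 < e"
    have "eventually (\<lambda>n. r (s n x) (L x) < e) sequentially"
      using lim[OF x] e by (rule order_tendstoD)
    then show "eventually (\<lambda>n. (\<integral>\<^sup>+u\<in>(s n -` U \<inter> J). ennreal (g (W x u)) \<partial>M) \<le> ?C + ennreal e) sequentially"
    proof eventually_elim
      case (elim n)
      \<comment> \<open>The chain replaces \<open>W x u\<close> by \<open>W (s n x) (s n u)\<close>,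
        valid almost everywhere, transports the integral to \<open>U\<close> by invariance of the
        measure, and then exchanges \<open>s n x\<close> for \<open>L x\<close> at the cost
        \<open>r (s n x) (L x)\<close>.\<close>
      have sx: "s n x \<in> J" by (rule Aut_closed[OF s x])
      have dm: "(\<lambda>u. ennreal \<bar>W (s n x) u - W (L x) u\<bar>) \<in> borel_measurable M"
        using W_measurable[OF sx] W_measurable[OF Lx] by measurable
      have "(\<integral>\<^sup>+u\<in>(s n -` U \<inter> J). ennreal (g (W x u)) \<partial>M)
          = (\<integral>\<^sup>+u\<in>(s n -` U \<inter> J). ennreal (g (W (s n x) (s n u))) \<partial>M)"
        by (rule nn_integral_cong_AE) (use Aut_AE_W[OF s x, of n] in \<open>eventually_elim, simp\<close>)
      also have "\<dots> = (\<integral>\<^sup>+u\<in>U. ennreal (g (W (s n x) u)) \<partial>M)"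
        by (rule set_nn_integral_vimage[OF Aut_measurable[OF s] Aut_distr[OF s] gW[OF sx] Um])
      also have "\<dots> \<le> (\<integral>\<^sup>+u. ennreal (g (W (L x) u)) * indicator U u + ennreal \<bar>W (s n x) u - W (L x) u\<bar> \<partial>M)"
      proof (rule nn_integral_mono)
        fix u
        have "ennreal (g (W (s n x) u)) \<le> ennreal (g (W (L x) u)) + ennreal \<bar>W (s n x) u - W (L x) u\<bar>"
        proof -
          \<comment> \<open>The sign of \<open>g\<close> is not restricted, while
            \<open>ennreal_plus\<close> needs nonnegative summands; truncation at \<open>0\<close>
            supplies this and leaves the \<open>ennreal\<close> value unchanged.\<close>
          have "g (W (s n x) u) \<le> max 0 (g (W (L x) u)) + \<bar>W (s n x) u - W (L x) u\<bar>"
            using g(1)[of "W (s n x) u" "W (L x) u"] by linarith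
          then have "ennreal (g (W (s n x) u)) \<le> ennreal (max 0 (g (W (L x) u)) + \<bar>W (s n x) u - W (L x) u\<bar>)"
            by (rule ennreal_leI)
          also have "\<dots> = ennreal (max 0 (g (W (L x) u))) + ennreal \<bar>W (s n x) u - W (L x) u\<bar>"
            by (rule ennreal_plus) auto
          also have "ennreal (max 0 (g (W (L x) u))) = ennreal (g (W (L x) u))" by simp
          finally show ?thesis .
        qed
        then show "ennreal (g (W (s n x) u)) * indicator U u
            \<le> ennreal (g (W (L x) u)) * indicator U u + ennreal \<bar>W (s n x) u - W (L x) u\<bar>"
          by (simp add: indicator_def)
      qed
      also have "\<dots> = ?C + (\<integral>\<^sup>+u. ennreal \<bar>W (s n x) u - W (L x) u\<bar> \<partial>M)"
        using gW[OF Lx] Um dm by (intro nn_integral_add) auto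
      also have "(\<integral>\<^sup>+u. ennreal \<bar>W (s n x) u - W (L x) u\<bar> \<partial>M) = ennreal (r (s n x) (L x))"
        unfolding nbhd_dist_def by (rule nn_integral_eq_integral[OF integrable_W_diff[OF sx Lx]]) simp
      also have "\<dots> \<le> ennreal e" using elim by (intro ennreal_leI) simp
      finally show ?case by (simp add: add_left_mono)
    qed
  qed
  also have "?C = (\<integral>\<^sup>+u\<in>(L -` U \<inter> J). ennreal (g (W (L x) (L u))) \<partial>M)"
    by (rule set_nn_integral_vimage[OF mp gW[OF Lx] Um, symmetric])
  finally show ?thesis .
qed

lemma set_nn_integral_complement:
  fixes f :: "'a \<Rightarrow> real"
  assumes f: "f \<in> borel_measurable M" "\<And>x. x \<in> J \<Longrightarrow> 0 \<le> f x \<and> f x \<le> 1" and V: "V \<in> sets M"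
  shows "(\<integral>\<^sup>+x\<in>V. ennreal (f x) \<partial>M) + (\<integral>\<^sup>+x\<in>V. ennreal (1 - f x) \<partial>M) = emeasure M V"
proof -
  have "(\<integral>\<^sup>+x\<in>V. ennreal (f x) \<partial>M) + (\<integral>\<^sup>+x\<in>V. ennreal (1 - f x) \<partial>M)
      = (\<integral>\<^sup>+x. ennreal (f x) * indicator V x + ennreal (1 - f x) * indicator V x \<partial>M)"
    by (rule nn_integral_add[symmetric]) (use f(1) V in measurable)
  also have "\<dots> = (\<integral>\<^sup>+x. indicator V x \<partial>M)"
    by (rule nn_integral_cong) (use f(2) in \<open>auto simp: indicator_def simp flip: ennreal_plus\<close>)
  also have "\<dots> = emeasure M V" using V by simp
  finally show ?thesis .
qed

lemma limit_in_Aut: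
  assumes s: "\<And>n. s n \<in> Aut"
    and L: "L \<in> extensional J" "L \<in> J \<rightarrow> J" "\<And>x. x \<in> J \<Longrightarrow> (\<lambda>n. r (s n x) (L x)) \<longlonglongrightarrow> 0"
    and L': "L' \<in> J \<rightarrow> J" "\<And>x. x \<in> J \<Longrightarrow> (\<lambda>n. r (inv_map (s n) x) (L' x)) \<longlonglongrightarrow> 0"
  shows "L \<in> Aut"
proof -
  let ?t = "\<lambda>n. inv_map (s n)"
  have t: "?t n \<in> Aut" for n by (rule Aut_inv[OF s])
  have LL': "L (L' x) = x" if "x \<in> J" for x
    by (rule limit_inverse[OF s Aut_closed[OF t] Aut_inv_right[OF s] L(2,3) L' that])
  have L'L: "L' (L x) = x" if "x \<in> J" for x
    by (rule limit_inverse[OF t Aut_closed[OF s] Aut_inv_left[OF s] L' L(2,3) that])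
  have "bij_betw L J J"
    by (rule bij_betw_byWitness[of J L' L J]) (use LL' L'L funcset_mem[OF L(2)] funcset_mem[OF L'(1)] in blast)+
  then have Bij: "L \<in> Bij J" using L(1) by (simp add: Bij_def)
  have op: "openin R.mtopology (L -` U \<inter> J)" if "openin R.mtopology U" for U
    by (rule isometry_vimage_open[OF L(2) limit_isometry[OF s L(2,3)] that])
  have op': "openin R.mtopology (L' -` U \<inter> J)" if "openin R.mtopology U" for U
    by (rule isometry_vimage_open[OF L'(1) limit_isometry[OF t L'] that])
  have vim: "L' -` (L -` U \<inter> J) \<inter> J = U" if "U \<subseteq> J" for U
    using that LL' funcset_mem[OF L'(1)] by (auto simp: subset_iff)
  have vim': "L -` (L' -` U \<inter> J) \<inter> J = U" if "U \<subseteq> J" for U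
    using that L'L funcset_mem[OF L(2)] by (auto simp: subset_iff)
  \<comment> \<open>Fatou's lemma yields only one inequality. The other follows by applying it to
    the limit \<open>L'\<close> of the inverses and to the open set of points that \<open>L\<close>
    sends into \<open>U\<close>.\<close>
  have em: "emeasure M (L -` U \<inter> J) = emeasure M U" if U: "openin R.mtopology U" for U
  proof (rule antisym)
    show "emeasure M (L -` U \<inter> J) \<le> emeasure M U"
      by (rule emeasure_vimage_limit_le[OF s L(2,3) U])
    show "emeasure M U \<le> emeasure M (L -` U \<inter> J)"
      using emeasure_vimage_limit_le[OF t L' op[OF U]] unfolding vim[OF open_subset_J[OF U]] .
  qed
  note mp = measure_preserving_if_open[OF L(2) op em]
  have "AE u in M. W (L x) (L u) = W x u" if x: "x \<in> J" for x
  proof (rule AE_eq_if_open)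
    have Lx: "L x \<in> J" by (rule funcset_mem[OF L(2) x])
    have LJ: "L u \<in> J" if "u \<in> J" for u by (rule funcset_mem[OF L(2) that])
    show m1: "(\<lambda>u. W (L x) (L u)) \<in> borel_measurable M"
      by (rule measurable_compose[OF mp(1) W_measurable[OF Lx]])
    show b1: "0 \<le> W (L x) (L u) \<and> W (L x) (L u) \<le> 1" if "u \<in> J" for u
      using W_nonneg[OF Lx LJ[OF that]] W_le_1[OF Lx LJ[OF that]] by simp
    show m2: "W x \<in> borel_measurable M" by (rule W_measurable[OF x])
    show b2: "0 \<le> W x u \<and> W x u \<le> 1" if "u \<in> J" for u
      using W_nonneg[OF x that] W_le_1[OF x that] by simp
    fix V assume V: "openin R.mtopology V"
    have Vm: "V \<in> sets M" by (rule open_measurable[OF V])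
    \<comment> \<open>The inequality concerns preimages under \<open>L\<close>; every open
      \<open>V\<close> is one, namely that of its own preimage under \<open>L'\<close>, which is
      again open.\<close>
    note le = limit_W_integral_le[OF s L(2,3) mp op'[OF V] x, unfolded vim'[OF open_subset_J[OF V]]]
    have le1: "(\<integral>\<^sup>+u\<in>V. ennreal (W x u) \<partial>M) \<le> (\<integral>\<^sup>+u\<in>V. ennreal (W (L x) (L u)) \<partial>M)"
      by (rule le[of "\<lambda>a. a"]) auto
    have le2: "(\<integral>\<^sup>+u\<in>V. ennreal (1 - W x u) \<partial>M) \<le> (\<integral>\<^sup>+u\<in>V. ennreal (1 - W (L x) (L u)) \<partial>M)"
      by (rule le[of "\<lambda>a. 1 - a"]) auto
    \<comment> \<open>For both functions the integrals of the function and of its complement to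
      \<open>1\<close> add up to the finite measure of \<open>V\<close>. The inequalities
      \<open>le1\<close> and \<open>le2\<close> therefore force equality.\<close>
    have cancel: "a \<le> c" if "a + b \<le> c + b" "b \<noteq> \<infinity>" for a b c :: ennreal
      using ennreal_add_left_cancel_le[of b a c] that by (simp add: add.commute)
    note c1 = set_nn_integral_complement[OF m1 b1 Vm] and c2 = set_nn_integral_complement[OF m2 b2 Vm]
    have fin: "(\<integral>\<^sup>+u\<in>V. ennreal (1 - W (L x) (L u)) \<partial>M) \<noteq> \<infinity>"
    proof
      assume "(\<integral>\<^sup>+u\<in>V. ennreal (1 - W (L x) (L u)) \<partial>M) = \<infinity>"
      with c1 have "emeasure M V = \<infinity>" by (simp add: top_add)
      with emeasure_finite[of V] show False by simp
    qed
    have "(\<integral>\<^sup>+u\<in>V. ennreal (W (L x) (L u)) \<partial>M) + (\<integral>\<^sup>+u\<in>V. ennreal (1 - W (L x) (L u)) \<partial>M)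
        \<le> (\<integral>\<^sup>+u\<in>V. ennreal (W x u) \<partial>M) + (\<integral>\<^sup>+u\<in>V. ennreal (1 - W (L x) (L u)) \<partial>M)"
      by (rule ord_eq_le_trans[OF trans[OF c1 c2[symmetric]] add_left_mono[OF le2]])
    then have "(\<integral>\<^sup>+u\<in>V. ennreal (W (L x) (L u)) \<partial>M) \<le> (\<integral>\<^sup>+u\<in>V. ennreal (W x u) \<partial>M)"
      using fin by (rule cancel)
    with le1 show "(\<integral>\<^sup>+u\<in>V. ennreal (W (L x) (L u)) \<partial>M) = (\<integral>\<^sup>+u\<in>V. ennreal (W x u) \<partial>M)"
      by (rule antisym[rotated])
  qed
  then show ?thesis using Bij mp by (simp add: graphon_auto_def)
qed

section \<open>Convergence of Cauchy sequences of automorphisms, and compactness\<close>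

lemma Aut_mcomplete: "A.mcomplete"
  unfolding A.mcomplete_def
proof (intro allI impI)
  fix s assume C: "A.MCauchy s"
  have s: "s n \<in> Aut" for n using C by (auto simp: A.MCauchy_def)
  have cauchy: "\<exists>N. \<forall>m\<ge>N. \<forall>n\<ge>N. \<forall>x\<in>J. r2 (s m x) (s n x) < e" if e: "0 < e" for e
  proof -
    obtain N where N: "\<And>m n. N \<le> m \<Longrightarrow> N \<le> n \<Longrightarrow> aut_dist M W (s m) (s n) < e"
      using C e unfolding A.MCauchy_def by blast
    have "r2 (s m x) (s n x) < e" if "N \<le> m" "N \<le> n" "x \<in> J" for m n x
      using le_unif_dist[OF s s that(3), of m n] N[OF that(1,2)] unfolding aut_dist_eq[OF s s] by linarith
    then show ?thesis by blast
  qed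
  let ?t = "\<lambda>n. inv_map (s n)"
  have t: "?t n \<in> Aut" for n by (rule Aut_inv[OF s])
  \<comment> \<open>Inversion preserves the uniform distance: for \<open>y = ?t n x\<close>,
    applying \<open>s m\<close> to \<open>?t m x\<close> and \<open>y\<close> gives
    \<open>s n y\<close> and \<open>s m y\<close>.\<close>
  have cauchy': "\<exists>N. \<forall>m\<ge>N. \<forall>n\<ge>N. \<forall>x\<in>J. r2 (?t m x) (?t n x) < e" if e: "0 < e" for e
  proof -
    obtain N where N: "\<forall>m\<ge>N. \<forall>n\<ge>N. \<forall>x\<in>J. r2 (s m x) (s n x) < e" using cauchy[OF e] by blast
    have "r2 (?t m x) (?t n x) < e" if mn: "N \<le> m" "N \<le> n" and x: "x \<in> J" for m n x
    proof -
      define y where "y = ?t n x"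
      have y: "y \<in> J" unfolding y_def by (rule Aut_closed[OF t x])
      have "r2 (?t m x) y = r2 (s m (?t m x)) (s m y)"
        by (rule Aut_r2[OF s Aut_closed[OF t x] y, symmetric])
      also have "s m (?t m x) = s n y" unfolding y_def by (simp only: Aut_inv_right[OF s x])
      finally have "r2 (?t m x) y = r2 (s n y) (s m y)" .
      then show ?thesis using N mn y unfolding y_def by simp
    qed
    then show ?thesis by blast
  qed
  obtain L where L: "L \<in> extensional J" "L \<in> J \<rightarrow> J" "\<And>x. x \<in> J \<Longrightarrow> (\<lambda>n. r (s n x) (L x)) \<longlonglongrightarrow> 0"
    by (rule pointwise_limit[of s, OF s cauchy]) (assumption, rule that)
  obtain L' where L': "L' \<in> J \<rightarrow> J" "\<And>x. x \<in> J \<Longrightarrow> (\<lambda>n. r (?t n x) (L' x)) \<longlonglongrightarrow> 0"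
    by (rule pointwise_limit[of ?t, OF t cauchy']) (assumption, rule that)
  have LA: "L \<in> Aut" by (rule limit_in_Aut[OF s L L'])
  have "limitin A.mtopology s L sequentially"
    unfolding A.limitin_metric
  proof (intro conjI allI impI)
    fix e :: real assume "0 < e"
    then have "0 < e / 2" by simp
    then obtain N where N: "\<forall>m\<ge>N. \<forall>n\<ge>N. \<forall>x\<in>J. r2 (s m x) (s n x) < e / 2" using cauchy by blast
    have "aut_dist M W (s n) L < e" if n: "N \<le> n" for n
    proof -
      have "r2 (s n x) (L x) \<le> e / 2" if x: "x \<in> J" for x
      proof -
        have J: "s m x \<in> J" "L x \<in> J" for m by (rule Aut_closed[OF s x], rule Aut_closed[OF LA x])
        \<comment> \<open>Letting \<open>m\<close> tend to infinity removes the last term. As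
          \<open>N\<close> does not depend on \<open>x\<close>, pointwise convergence in
          \<open>r\<close> is thereby upgraded to uniform convergence in \<open>r2\<close>.\<close>
        have "r2 (s n x) (L x) \<le> e / 2 + r (s m x) (L x)" if m: "N \<le> m" for m
        proof -
          have "r2 (s n x) (s m x) < e / 2" using N n m x by blast
          then show ?thesis
            using R2.triangle[OF J(1)[of n] J(1)[of m] J(2)] nbhd2_dist_le_nbhd_dist[OF J(1)[of m] J(2)]
            by linarith
        qed
        moreover have "(\<lambda>m. e / 2 + r (s m x) (L x)) \<longlonglongrightarrow> e / 2"
          using tendsto_add[OF tendsto_const L(3)[OF x]] by simp
        ultimately show ?thesis by (intro LIMSEQ_le_const) auto
      qed
      then have "unif_dist (s n) L \<le> e / 2" by (rule unif_dist_le)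
      then show ?thesis unfolding aut_dist_eq[OF s LA] using \<open>0 < e\<close> by linarith
    qed
    then show "eventually (\<lambda>n. s n \<in> Aut \<and> aut_dist M W (s n) L < e) sequentially"
      using s unfolding eventually_sequentially by blast
  qed (rule LA)
  then show "\<exists>L. limitin A.mtopology s L sequentially" by blast
qed

lemma graphon_Aut_compact:
  "group (graphon_Aut M W) \<and>
   Metric_space (carrier (graphon_Aut M W)) (aut_dist M W) \<and>
   compact_space (Metric_space.mtopology (carrier (graphon_Aut M W)) (aut_dist M W))"
  unfolding carrier_graphon_Aut
  using group_graphon_Aut A.Metric_space_axioms Aut_mcomplete Aut_mtotally_bounded
  by (simp add: A.compact_space_eq_mcomplete_mtotally_bounded)

end

theorem theorem3p4:
  fixes M :: "'a measure" and W :: "'a \<Rightarrow> 'a \<Rightarrow> real"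
  assumes "pure_graphon M W"
  shows "group (graphon_Aut M W) \<and>
         Metric_space (carrier (graphon_Aut M W)) (aut_dist M W) \<and>
         compact_space (Metric_space.mtopology (carrier (graphon_Aut M W)) (aut_dist M W))"
proof -
  interpret pure_graphon_space M W by unfold_locales (rule assms)
  show ?thesis by (rule graphon_Aut_compact)
qed

end
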